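(* Let $G=(V,E)$ be a finite simple graph without isolated vertices. For every $k\in\{1,\dots,n\}$, $c_k\le 1-h_k^+$; and if $\vec x$ is an eigenvector of $\Delta_1^+$ with eigenvalue $c_k$, then $1-h^+_{S(\vec x)}\le c_k$, where $S(\vec x)$ is the number of nodal domains of $\vec x$.
   Context: $V=\{1,\dots,n\}$, $d_i$ degree, $\mathrm{vol}(S)=\sum_{i\in S}d_i$, $|E(A,B)|$ the number of edges with one endpoint in $A$ and the other in $B$. $\mathrm{Sgn}(t)=\{1\},[-1,1],\{-1\}$ for $t>0,t=0,t<0$. $(\Delta_1^+\vec x)_i=\{\sum_{j:\{i,j\}\in E}z_{ij}: z_{ij}\in\mathrm{Sgn}(x_i+x_j),z_{ij}=z_{ji}\}$; $(\lambda,\vec x)$ is an eigenpair of $\Delta_1^+$ if $\vec x\neq\vec 0$ and $\Delta_1^+\vec x\cap\lambda\,\mathrm{diag}(d_i)\mathrm{Sgn}(\vec x)\ne\emptyset$. $I^+(\vec x)=\sum_{\{i,j\}\in E}|x_i+x_j|$, $X=\{\vec x:\sum_i d_i|x_i|=1\}$, $c_k=\inf\{\sup_{\vec x\in A}I^+(\vec x): A\subseteq X\text{ compact}, A=-A,\gamma(A)\ge k\}$ with $\gamma$ the Krasnoselskii genus. Nodal domains of $\vec x$: vertex sets of connected components of the subgraph induced by $\{i:x_i\ne0\}$. The $k$-way dual Cheeger constant is $h_k^+=\max\min_{1\le i\le k}\frac{2|E(V_{2i-1},V_{2i})|}{\mathrm{vol}(V_{2i-1}\cup V_{2i})}$, the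 maximum over families of pairwise disjoint subsets $V_1,\dots,V_{2k}\subseteq V$ with $V_{2i-1}\cup V_{2i}\ne\emptyset$ for each $i$. *)

theory Defs
  imports "HOL-Analysis.Analysis"
begin

text \<open>
  The vertex set is a finite type \<open>'v\<close>, so that \<open>n = CARD('v)\<close> and vectors indexed by
  vertices have type \<open>real^'v\<close>. A graph is given by its set of edges, each a two-element set
  of vertices.
\<close>

definition simple_graph :: "'v::finite set set \<Rightarrow> bool" where
  "simple_graph E \<longleftrightarrow> (\<forall>e\<in>E. card e = 2)"

definition vertex_degree :: "'v::finite set set \<Rightarrow> 'v \<Rightarrow> nat" where
  "vertex_degree E i = card {e \<in> E. i \<in> e}"

definition no_isolated_vertices :: "'v::finite set set \<Rightarrow> bool" where
  "no_isolated_vertices E \<longleftrightarrow> (\<forall>i. vertex_degree E i \<noteq> 0)"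

definition vol :: "'v::finite set set \<Rightarrow> 'v set \<Rightarrow> nat" where
  "vol E S = (\<Sum>i\<in>S. vertex_degree E i)"

definition edges_between :: "'v::finite set set \<Rightarrow> 'v set \<Rightarrow> 'v set \<Rightarrow> 'v set set" where
  "edges_between E A B = {e \<in> E. \<exists>a\<in>A. \<exists>b\<in>B. e = {a, b}}"

definition Sgn :: "real \<Rightarrow> real set" where
  "Sgn t = (if t > 0 then {1} else if t < 0 then {-1} else {-1..1})"

text \<open>
  The set-valued operator \<open>\<Delta>\<^sub>1\<^sup>+\<close>: a single symmetric choice \<open>z\<close> is shared by all coordinates,
  so the value at \<open>x\<close> is a set of vectors and not a product of coordinate sets.
\<close>

definition signless_one_laplacian :: "'v::finite set set \<Rightarrow> real^'v \<Rightarrow> (real^'v) set" where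
  "signless_one_laplacian E x =
     {y. \<exists>z :: 'v \<Rightarrow> 'v \<Rightarrow> real.
           (\<forall>i j. {i, j} \<in> E \<longrightarrow> z i j \<in> Sgn (x $ i + x $ j) \<and> z i j = z j i) \<and>
           (\<forall>i. y $ i = (\<Sum>j | {i, j} \<in> E. z i j))}"

definition weighted_Sgn :: "'v::finite set set \<Rightarrow> real^'v \<Rightarrow> (real^'v) set" where
  "weighted_Sgn E x =
     {w. \<exists>s. (\<forall>i. s i \<in> Sgn (x $ i)) \<and> (\<forall>i. w $ i = real (vertex_degree E i) * s i)}"

definition eigenpair :: "'v::finite set set \<Rightarrow> real \<Rightarrow> real^'v \<Rightarrow> bool" where
  "eigenpair E lam x \<longleftrightarrow>
     x \<noteq> 0 \<and> signless_one_laplacian E x \<inter> (\<lambda>w. lam *\<^sub>R w) ` weighted_Sgn E x \<noteq> {}"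

text \<open>For an edge \<open>e = {i, j}\<close> of a simple graph the inner sum is \<open>x\<^sub>i + x\<^sub>j\<close>.\<close>

definition I_plus :: "'v::finite set set \<Rightarrow> real^'v \<Rightarrow> real" where
  "I_plus E x = (\<Sum>e\<in>E. \<bar>\<Sum>i\<in>e. x $ i\<bar>)"

definition X_sphere :: "'v::finite set set \<Rightarrow> (real^'v) set" where
  "X_sphere E = {x. (\<Sum>i\<in>UNIV. real (vertex_degree E i) * \<bar>x $ i\<bar>) = 1}"

text \<open>
  The Krasnoselskii genus of a symmetric set \<open>A\<close>: the least \<open>m\<close> admitting an odd continuous map
  from \<open>A\<close> to \<open>\<real>\<^sup>m - {0}\<close>, and \<open>\<infinity>\<close> if there is none. The space \<open>\<real>\<^sup>m\<close> is the library's
  \<open>Euclidean_space m\<close>, whose points are functions \<open>nat \<Rightarrow> real\<close> vanishing from \<open>m\<close> on. The empty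
  set has genus \<open>0\<close>, the case \<open>m = 0\<close>.
\<close>

definition genus :: "'a::real_normed_vector set \<Rightarrow> enat" where
  "genus A = Inf {enat m | m. \<exists>g. continuous_map (top_of_set A) (Euclidean_space m) g \<and>
                     (\<forall>x\<in>A. g (- x) = (\<lambda>i. - g x i)) \<and> (\<forall>x\<in>A. g x \<noteq> (\<lambda>i. 0))}"

definition minimax_c :: "'v::finite set set \<Rightarrow> nat \<Rightarrow> real" where
  "minimax_c E k =
     Inf {(SUP x\<in>A. I_plus E x) | A.
            A \<subseteq> X_sphere E \<and> compact A \<and> A = uminus ` A \<and> genus A \<ge> enat k}"

definition nodal_domains :: "'v::finite set set \<Rightarrow> real^'v \<Rightarrow> 'v set set" where
  "nodal_domains E x =
     {i. x $ i \<noteq> 0} // {(i, j). x $ i \<noteq> 0 \<and> x $ j \<noteq> 0 \<and> {i, j} \<in> E}\<^sup>*"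

definition dual_cheeger :: "'v::finite set set \<Rightarrow> nat \<Rightarrow> real" where
  "dual_cheeger E k =
     Max {(MIN i\<in>{1..k}. 2 * real (card (edges_between E (V (2 * i - 1)) (V (2 * i))))
                           / real (vol E (V (2 * i - 1) \<union> V (2 * i)))) | V :: nat \<Rightarrow> 'v set.
            disjoint_family_on V {1..2 * k} \<and> (\<forall>i\<in>{1..k}. V (2 * i - 1) \<union> V (2 * i) \<noteq> {})}"

end

theory Submission
  imports Defs "HOL-Library.Z2"
begin

text \<open>
  The first inequality tests the minimax with the octahedral sphere spanned by the vectors
  \<open>(1\<^sub>A - 1\<^sub>B) / vol (A \<union> B)\<close> over the pairs \<open>(A, B)\<close> of an optimal family. On it \<open>I\<^sup>+\<close> is at most
  its largest value at a spanning vector, and that value is \<open>1 - 2 |E(A, B)| / vol (A \<union> B)\<close>. The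
  sphere has genus at least \<open>k\<close> by the Borsuk--Ulam theorem, which is obtained from Tucker's lemma
  on a cubical grid: modulo 2, Ky Fan's count of simplices with alternating labels is carried
  through a flag of antipodally symmetric hemispheres of the boundary of the cube.

  For the second inequality, splitting a nodal domain by the sign of \<open>x\<close> gives a pair for which
  the eigenvalue equation yields equality, \<open>1 - 2 |E(A, B)| / vol (A \<union> B) = \<lambda>\<close>.
\<close>

text \<open>The genus bound is the topological core, and it is a parity statement: counts take
  values in \<open>bit\<close>, so no orientations occur and every cancellation is a + a = 0. One
  deletion identity, \<open>sum_alternating_remove1\<close>, does two jobs. For labels it says that
  the coboundary of the cochain of simplices alternating from \<open>s\<close> counts the simplices
  one dimension higher that alternate from either sign. For the signs of a face it says that the
  boundary of a hemisphere is the next hemisphere plus its antipode. Passing to the antipode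
  exchanges the two starting signs of the labels, so the total over both starts,
  \<open>alt_count m\<close>, is the same in every codimension \<open>m\<close>. For
  \<open>m = n\<close> a single vertex is left, which counts once; for \<open>m = 0\<close> there
  are n + 1 labels without opposite pair but only n absolute values, so nothing alternates. The
  octahedral sphere suits the functional as well: the spanning vectors have disjoint supports, so
  the l1 norm of the coefficients equals the weighted norm that defines \<open>X_sphere\<close>, and
  \<open>I_plus\<close> is a seminorm.\<close>

section \<open>Alternating labels\<close>

text \<open>By default the simplifier turns addition on \<open>bit\<close> into exclusive or, losing the ring structure.\<close>

declare add_bit_eq_xor [simp del] mult_bit_eq_and [simp del]

lemma bit_add_self [simp]: "a + a = (0::bit)" "a + (a + b) = (b::bit)"
  by (cases a; cases b; simp)+

fun alternating :: "bool \<Rightarrow> bool list \<Rightarrow> bool" where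
  "alternating s [] = True"
| "alternating s (b # bs) = (b = s \<and> alternating (\<not> s) bs)"

lemma alternating_map_Not: "alternating s (map Not bs) = alternating (\<not> s) bs"
  by (induction bs arbitrary: s) auto

text \<open>A list alternating from \<open>s\<close> contributes through its last entry, one
  alternating from \<open>\<not> s\<close> through its first. Any other list that a deletion makes
  alternating has exactly one pair of equal neighbours, and the deletions of these two cancel modulo
  2.\<close>

lemma sum_alternating_remove1:
  assumes "sorted xs"
  shows "(\<Sum>x\<leftarrow>xs. of_bool (alternating s (map f (remove1 x xs)))) =
         (of_bool (alternating s (map f xs)) + of_bool (alternating (\<not> s) (map f xs)) :: bit)"
  using assms
proof (induction xs arbitrary: s)
  case (Cons c cs)
  \<comment> \<open>If \<open>x\<close> equals the head \<open>c\<close>, then by sortedness the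
    tail also begins with \<open>c\<close>, so it does not matter which copy is deleted.\<close>
  have eq: "remove1 x (c # cs) = c # remove1 x cs" if "x \<in> set cs" for x
    using that Cons.prems by (cases cs) auto
  have "(\<Sum>x\<leftarrow>cs. of_bool (alternating s (map f (remove1 x (c # cs))))) =
        (\<Sum>x\<leftarrow>cs. of_bool (f c = s) * of_bool (alternating (\<not> s) (map f (remove1 x cs))) :: bit)"
    by (intro arg_cong[where f = sum_list] map_cong refl) (simp only: eq, simp)
  also have "\<dots> = of_bool (f c = s) * (\<Sum>x\<leftarrow>cs. of_bool (alternating (\<not> s) (map f (remove1 x cs))))"
    by (simp only: sum_list_const_mult)
  also have "\<dots> = of_bool (f c = s) *
      (of_bool (alternating (\<not> s) (map f cs)) + of_bool (alternating s (map f cs)))"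
    using Cons by simp
  finally show ?case
    by (cases "f c = s") auto
qed auto

text \<open>The sum over all deletions of one vertex, without signs as it is modulo 2. The recursion
  peels off vertices in the order in which \<open>cell_sum\<close> adds them.\<close>

fun coboundary :: "('a list \<Rightarrow> bit) \<Rightarrow> 'a list \<Rightarrow> bit" where
  "coboundary H [] = 0"
| "coboundary H (x # xs) = H xs + coboundary (\<lambda>l. H (x # l)) xs"

lemma coboundary_mset:
  "coboundary (\<lambda>l. F (mset l)) xs = (\<Sum>x\<in>#mset xs. F (mset xs - {#x#}))"
proof (induction xs arbitrary: F)
  case (Cons y ys)
  have "(\<Sum>x\<in>#mset ys. F (add_mset y (mset ys - {#x#}))) =
        (\<Sum>x\<in>#mset ys. F (add_mset y (mset ys) - {#x#}))"
    using diff_union_single_conv[of _ "mset ys" "{#y#}"]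
    by (intro arg_cong[where f = sum_mset] image_mset_cong) simp
  then show ?case
    using Cons[of "\<lambda>M. F (add_mset y M)"] by simp
qed simp

lemma coboundary_map: "coboundary (\<lambda>l. H (map g l)) xs = coboundary H (map g xs)"
  by (induction xs arbitrary: H) (simp_all)

text \<open>Ky Fan's cochain: it does not depend on the order of the labels.\<close>

definition alt_cochain :: "bool \<Rightarrow> nat list \<Rightarrow> bit" where
  "alt_cochain s xs = of_bool (alternating s (map even (sort xs)))"

text \<open>The cochain depends only on the multiset of labels, so deleting a vertex amounts to
  deleting an entry of the sorted label list, and the deletion identity applies.\<close>

lemma coboundary_alt_cochain:
  "coboundary (alt_cochain s) xs = alt_cochain s xs + alt_cochain (\<not> s) xs"
proof -
  define F :: "nat multiset \<Rightarrow> bit"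
    where "F = (\<lambda>M. of_bool (alternating s (map even (sorted_list_of_multiset M))))"
  have "alt_cochain s = (\<lambda>l. F (mset l))"
    by (auto simp: F_def alt_cochain_def)
  then have "coboundary (alt_cochain s) xs = (\<Sum>x\<in>#mset (sort xs). F (mset xs - {#x#}))"
    using coboundary_mset[of F xs] by simp
  also have "\<dots> = (\<Sum>x\<leftarrow>sort xs. F (mset xs - {#x#}))"
    by (simp only: sum_mset_sum_list flip: mset_map)
  also have "\<dots> = (\<Sum>x\<leftarrow>sort xs. of_bool (alternating s (map even (remove1 x (sort xs)))))"
  proof -
    have "sorted_list_of_multiset (mset xs - {#x#}) = remove1 x (sort xs)" for x
      using sorted_list_of_multiset_mset[of "remove1 x (sort xs)"]
      by (simp add: sorted_sort_id sorted_remove1)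
    then show ?thesis by (simp add: F_def)
  qed
  also have "\<dots> = alt_cochain s xs + alt_cochain (\<not> s) xs"
    by (simp add: sum_alternating_remove1 alt_cochain_def)
  finally show ?thesis .
qed

text \<open>The label \<open>2 i\<close> stands for \<open>+i\<close> and \<open>2 i + 1\<close> for \<open>-i\<close>.\<close>

definition opp :: "nat \<Rightarrow> nat" where
  "opp l = (if even l then l + 1 else l - 1)"

lemma opp_div_2: "opp l div 2 = l div 2"
  and even_opp: "even (opp l) \<longleftrightarrow> odd l"
  by (auto simp: opp_def elim!: evenE oddE)

lemma div_2_less: "a \<le> b \<Longrightarrow> a \<noteq> b \<Longrightarrow> a \<noteq> opp b \<Longrightarrow> a div 2 < b div (2::nat)"
  by (cases "even a"; cases "even b") (auto simp: opp_def elim!: evenE oddE)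

text \<open>Without opposite pairs the order of labels is decided by their halves, which
  \<open>opp\<close> preserves; so \<open>opp\<close> commutes with sorting and flips every
  sign.\<close>

lemma alt_cochain_opp:
  assumes "\<forall>a\<in>set xs. opp a \<notin> set xs"
  shows "alt_cochain s (map opp xs) = alt_cochain (\<not> s) xs"
proof -
  have "sorted (map opp (sort xs))"
    unfolding sorted_map
  proof (rule sorted_wrt_mono_rel[OF _ sorted_sort[of xs]])
    fix a b assume "a \<in> set (sort xs)" "b \<in> set (sort xs)" "a \<le> b"
    then have "a = b \<or> a div 2 < b div 2"
      using assms div_2_less[of a b] by auto
    then show "opp a \<le> opp b"
      using div_le_mono[of "opp b" "opp a" 2] nat_le_linear[of "opp a" "opp b"]
      by (auto simp: opp_div_2)
  qed
  then have "sort (map opp xs) = map opp (sort xs)"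
    by (intro properties_for_sort) simp_all
  then have "map even (sort (map opp xs)) = map Not (map even (sort xs))"
    by (simp add: even_opp)
  then show ?thesis
    by (simp add: alt_cochain_def alternating_map_Not del: map_map)
qed

text \<open>Alternation excludes equal neighbours and the hypothesis excludes opposite ones, so the
  halves increase strictly and stay below \<open>n\<close>. The lower bound \<open>c\<close> is
  carried along for the induction.\<close>

lemma alternating_length_le:
  assumes "sorted xs" "alternating s (map even xs)" "\<forall>a\<in>set xs. opp a \<notin> set xs"
      and "\<forall>a\<in>set xs. c \<le> a div 2 \<and> a < 2 * n" "c \<le> n"
  shows "length xs + c \<le> n"
  using assms
proof (induction xs arbitrary: s c)
  case (Cons a xs)
  have "Suc (a div 2) \<le> b div 2" if b: "b \<in> set xs" for b
  proof -
    have "a \<le> b" "opp b \<noteq> a" using Cons.prems b by auto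
    moreover have "a \<noteq> b"
    proof
      assume "a = b"
      with b Cons.prems(1) obtain ys where "xs = a # ys"
        by (cases xs) auto
      then show False using Cons.prems(2) by auto
    qed
    ultimately show ?thesis
      using div_2_less[of a b] by auto
  qed
  then have "length xs + Suc (a div 2) \<le> n"
    using Cons.prems by (intro Cons.IH[of "\<not> s"]) auto
  then show ?case using Cons.prems(4) by auto
qed auto

lemma alt_cochain_eq_0:
  assumes "\<forall>a\<in>set xs. opp a \<notin> set xs \<and> a < 2 * n" "n < length xs"
  shows "alt_cochain s xs = 0"
  using alternating_length_le[of "sort xs" s 0 n] assms by (auto simp: alt_cochain_def)

section \<open>The standard triangulation of grid cells\<close>

text \<open>
  The sum of \<open>H\<close> over the maximal simplices of Kuhn's triangulation of the cell with lowest corner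
  \<open>v\<close> and edge directions \<open>D\<close>; they are the monotone edge paths from \<open>v\<close> to the opposite corner.
\<close>

function cell_sum :: "((nat \<Rightarrow> int) list \<Rightarrow> bit) \<Rightarrow> (nat \<Rightarrow> int) \<Rightarrow> nat set \<Rightarrow> bit" where
  "cell_sum H v D = (if finite D \<and> D \<noteq> {}
     then \<Sum>d\<in>D. cell_sum (\<lambda>l. H (v # l)) (v(d := v d + 1)) (D - {d}) else H [v])"
  by auto
termination
  by (relation "Wellfounded.measure (\<lambda>(_, _, D). card D)") (auto simp: card_gt_0_iff)

declare cell_sum.simps [simp del]

lemma cell_sum_empty [simp]: "cell_sum H v {} = H [v]"
  by (simp add: cell_sum.simps)

lemma cell_sum_step:
  "finite D \<Longrightarrow> D \<noteq> {} \<Longrightarrow>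
   cell_sum H v D = (\<Sum>d\<in>D. cell_sum (\<lambda>l. H (v # l)) (v(d := v d + 1)) (D - {d}))"
  by (subst cell_sum.simps) simp

lemma cell_sum_add:
  "finite D \<Longrightarrow> cell_sum (\<lambda>l. H l + H' l) v D = cell_sum H v D + cell_sum H' v D"
proof (induction "card D" arbitrary: D H H' v)
  case (Suc n)
  then have "D \<noteq> {}" by auto
  with Suc show ?case by (simp add: cell_sum_step sum.distrib)
qed simp

definition cell :: "(nat \<Rightarrow> int) \<Rightarrow> nat set \<Rightarrow> (nat \<Rightarrow> int) set" where
  "cell v D = {p. \<forall>i. v i \<le> p i \<and> p i \<le> v i + of_bool (i \<in> D)}"

lemma cell_sum_cong:
  assumes "finite D"
      and "\<And>l. set l \<subseteq> cell v D \<Longrightarrow> length l = Suc (card D) \<Longrightarrow> H l = H' l"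
  shows "cell_sum H v D = cell_sum H' v D"
  using assms
proof (induction "card D" arbitrary: D H H' v)
  case 0
  then show ?case by (auto simp: cell_def)
next
  case (Suc n)
  have "cell_sum (\<lambda>l. H (v # l)) (v(d := v d + 1)) (D - {d}) =
        cell_sum (\<lambda>l. H' (v # l)) (v(d := v d + 1)) (D - {d})" if d: "d \<in> D" for d
  proof (rule Suc.hyps)
    fix l assume l: "set l \<subseteq> cell (v(d := v d + 1)) (D - {d})" "length l = Suc (card (D - {d}))"
    have "cell (v(d := v d + 1)) (D - {d}) \<subseteq> cell v D"
    proof
      fix p assume p: "p \<in> cell (v(d := v d + 1)) (D - {d})"
      have "v i \<le> p i \<and> p i \<le> v i + of_bool (i \<in> D)" for i
        using p d by (cases "i = d") (auto simp: cell_def dest!: spec[of _ i])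
      then show "p \<in> cell v D" by (simp add: cell_def)
    qed
    with l have "set (v # l) \<subseteq> cell v D"
      by (auto simp: cell_def)
    then show "H (v # l) = H' (v # l)"
      using l Suc.hyps(2) d Suc.prems by (intro Suc.prems) auto
  qed (use Suc.hyps Suc.prems d in auto)
  moreover have "D \<noteq> {}" using Suc.hyps by auto
  ultimately show ?case using Suc.prems by (simp add: cell_sum_step)
qed

lemma sum_symmetric_eq_0:
  assumes "finite D" "\<And>d d'. f d d' = f d' d"
  shows "(\<Sum>d\<in>D. \<Sum>d'\<in>D - {d}. f d d') = (0::bit)"
  using assms(1)
proof induction
  case (insert x D)
  have "(\<Sum>d'\<in>insert x D - {d}. f d d') = f d x + (\<Sum>d'\<in>D - {d}. f d d')" if "d \<in> D" for d
  proof -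
    have "insert x D - {d} = insert x (D - {d})" "x \<notin> D - {d}" using that insert by auto
    then show ?thesis using insert by simp
  qed
  then have "(\<Sum>d\<in>D. \<Sum>d'\<in>insert x D - {d}. f d d') = (\<Sum>d\<in>D. f x d)"
    using insert by (simp add: sum.distrib assms(2)[of _ x])
  moreover have "insert x D - {x} = D" using insert by auto
  ultimately show ?case using insert by simp
qed simp

lemma sum_swap_off_diagonal:
  assumes "finite D"
  shows "(\<Sum>d\<in>D. \<Sum>d'\<in>D - {d}. f d d') = (\<Sum>d'\<in>D. \<Sum>d\<in>D - {d'}. f d d')"
proof -
  have eq: "(\<Sum>d'\<in>D - {d}. g d') = (\<Sum>d'\<in>D. if d' = d then 0 else g d')" for d g
    using assms by (intro sum.mono_neutral_cong_left) auto
  show ?thesis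
    unfolding eq by (subst sum.swap) (intro sum.cong, auto)
qed

text \<open>The internal faces of the triangulation of the cell occur twice and cancel.\<close>

lemma cell_sum_coboundary:
  assumes "finite D" "D \<noteq> {}"
  shows "cell_sum (coboundary H) v D =
    (\<Sum>d\<in>D. cell_sum H (v(d := v d + 1)) (D - {d}) + cell_sum H v (D - {d}))"
  using assms
proof (induction "card D" arbitrary: D H v)
  case (Suc n)
  show ?case
  proof (cases "n = 0")
    case True
    with Suc obtain d where "D = {d}" by (metis One_nat_def card_1_singletonE)
    then show ?thesis by (simp add: cell_sum_step)
  next
    case False
    let ?H = "\<lambda>l. H (v # l)"
    have ne: "D - {d} \<noteq> {}" for d
      using Suc.hyps(2) False card_mono[of "{d}" D] by auto
    have "cell_sum (coboundary H) v D =
      (\<Sum>d\<in>D. cell_sum H (v(d := v d + 1)) (D - {d})) +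
      (\<Sum>d\<in>D. cell_sum (coboundary ?H) (v(d := v d + 1)) (D - {d}))"
      using Suc.prems by (simp add: cell_sum_step[of D] cell_sum_add sum.distrib)
    also have "(\<Sum>d\<in>D. cell_sum (coboundary ?H) (v(d := v d + 1)) (D - {d})) =
      (\<Sum>d\<in>D. \<Sum>d'\<in>D - {d}.
         cell_sum ?H (v(d := v d + 1, d' := (v(d := v d + 1)) d' + 1)) (D - {d} - {d'}) +
         cell_sum ?H (v(d := v d + 1)) (D - {d} - {d'}))"
      using Suc.hyps Suc.prems ne by (intro sum.cong refl Suc.hyps) auto
    also have "\<dots> = (\<Sum>d\<in>D. \<Sum>d'\<in>D - {d}.
         cell_sum ?H (v(d := v d + 1, d' := (v(d := v d + 1)) d' + 1)) (D - {d} - {d'})) +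
      (\<Sum>d\<in>D. \<Sum>d'\<in>D - {d}. cell_sum ?H (v(d := v d + 1)) (D - {d} - {d'}))"
      by (simp only: sum.distrib)
    \<comment> \<open>These paths jump from \<open>v\<close> two steps ahead: the vertex in between
      was dropped, and it lies in direction \<open>d\<close> or \<open>d'\<close> depending on the
      order of the steps. Hence they come in equal pairs.\<close>
    also have "(\<Sum>d\<in>D. \<Sum>d'\<in>D - {d}.
         cell_sum ?H (v(d := v d + 1, d' := (v(d := v d + 1)) d' + 1)) (D - {d} - {d'})) = 0"
    proof (rule sum_symmetric_eq_0)
      fix d d'
      have "v(d := v d + 1, d' := (v(d := v d + 1)) d' + 1) =
            v(d' := v d' + 1, d := (v(d' := v d' + 1)) d + 1)"
        by (auto simp: fun_eq_iff)
      moreover have "D - {d} - {d'} = D - {d'} - {d}" by auto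
      ultimately show "cell_sum ?H (v(d := v d + 1, d' := (v(d := v d + 1)) d' + 1)) (D - {d} - {d'}) =
        cell_sum ?H (v(d' := v d' + 1, d := (v(d' := v d' + 1)) d + 1)) (D - {d'} - {d})"
        by simp
    qed (use Suc.prems in auto)
    \<comment> \<open>Here \<open>d'\<close> is the omitted direction, so collecting the first steps
      \<open>d\<close> gives back the sum over the facet of the cell at \<open>v\<close> without
      \<open>d'\<close>.\<close>
    also have "(\<Sum>d\<in>D. \<Sum>d'\<in>D - {d}. cell_sum ?H (v(d := v d + 1)) (D - {d} - {d'})) =
      (\<Sum>d'\<in>D. \<Sum>d\<in>D - {d'}. cell_sum ?H (v(d := v d + 1)) (D - {d'} - {d}))"
      using Suc.prems by (subst sum_swap_off_diagonal) (auto intro!: sum.cong simp: Diff_insert2[symmetric] insert_commute)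
    also have "\<dots> = (\<Sum>d'\<in>D. cell_sum H v (D - {d'}))"
      using Suc.prems ne by (intro sum.cong refl) (simp add: cell_sum_step)
    finally show ?thesis by (simp only: sum.distrib add_0_left)
  qed
qed auto

text \<open>Recursion on the last step of a path, needed because the reflection turns first steps
  into last ones.\<close>

lemma cell_sum_step_last:
  assumes "finite D" "D \<noteq> {}"
  shows "cell_sum H v D =
    (\<Sum>d\<in>D. cell_sum (\<lambda>l. H (l @ [\<lambda>i. v i + of_bool (i \<in> D)])) v (D - {d}))"
  using assms
proof (induction "card D" arbitrary: D H v)
  case (Suc n)
  show ?case
  proof (cases "n = 0")
    case True
    with Suc obtain d where "D = {d}" by (metis One_nat_def card_1_singletonE)
    moreover have "(\<lambda>i. v i + of_bool (i = d)) = v(d := v d + 1)" by auto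
    ultimately show ?thesis by (simp add: cell_sum_step)
  next
    case False
    let ?w = "\<lambda>i. v i + of_bool (i \<in> D)"
    have ne: "D - {d} \<noteq> {}" for d
      using Suc.hyps(2) False card_mono[of "{d}" D] by auto
    have w: "(\<lambda>i. (v(d := v d + 1)) i + of_bool (i \<in> D - {d})) = ?w" if "d \<in> D" for d
      using that by auto
    have "cell_sum H v D = (\<Sum>d\<in>D. cell_sum (\<lambda>l. H (v # l)) (v(d := v d + 1)) (D - {d}))"
      using Suc.prems by (rule cell_sum_step)
    also have "\<dots> = (\<Sum>d\<in>D. \<Sum>d'\<in>D - {d}.
        cell_sum (\<lambda>l. H (v # l @ [\<lambda>i. (v(d := v d + 1)) i + of_bool (i \<in> D - {d})]))
          (v(d := v d + 1)) (D - {d} - {d'}))"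
      using Suc.hyps Suc.prems ne by (intro sum.cong refl Suc.hyps) auto
    also have "\<dots> = (\<Sum>d\<in>D. \<Sum>d'\<in>D - {d}.
        cell_sum (\<lambda>l. H (v # l @ [?w])) (v(d := v d + 1)) (D - {d} - {d'}))"
      by (intro sum.cong refl) (simp only: w)
    also have "\<dots> = (\<Sum>d'\<in>D. \<Sum>d\<in>D - {d'}.
        cell_sum (\<lambda>l. H (v # l @ [?w])) (v(d := v d + 1)) (D - {d'} - {d}))"
      using Suc.prems by (subst sum_swap_off_diagonal) (auto intro!: sum.cong simp: Diff_insert2[symmetric] insert_commute)
    also have "\<dots> = (\<Sum>d'\<in>D. cell_sum (\<lambda>l. H (l @ [?w])) v (D - {d'}))"
      using Suc.prems ne by (intro sum.cong refl) (simp add: cell_sum_step)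
    finally show ?thesis .
  qed
qed auto

text \<open>Kuhn's triangulation is symmetric under the point reflection, which reverses the paths.\<close>

lemma cell_sum_antipode:
  assumes "finite D" "\<And>l. H (rev l) = H l"
  shows "cell_sum (\<lambda>l. H (map (\<lambda>p i. - p i) l)) v D =
         cell_sum H (\<lambda>i. - v i - of_bool (i \<in> D)) D"
proof -
  \<comment> \<open>The reversal is kept explicit for arbitrary \<open>H\<close>: the induction
    hypothesis is applied to an \<open>H\<close> with a vertex appended, for which invariance under
    reversal is lost.\<close>
  have "cell_sum (\<lambda>l. H (rev (map (\<lambda>p i. - p i) l))) v D =
         cell_sum H (\<lambda>i. - v i - of_bool (i \<in> D)) D" for H
    using assms(1)
  proof (induction "card D" arbitrary: D H v)
    case (Suc n)
    then have D: "finite D" "D \<noteq> {}" by auto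
    have "cell_sum (\<lambda>l. H (rev (map (\<lambda>p i. - p i) l) @ [\<lambda>i. - v i])) (v(d := v d + 1)) (D - {d}) =
      cell_sum (\<lambda>l. H (l @ [\<lambda>i. - v i])) (\<lambda>i. - v i - of_bool (i \<in> D)) (D - {d})"
      if d: "d \<in> D" for d
    proof -
      have "(\<lambda>i. - (v(d := v d + 1)) i - of_bool (i \<in> D - {d})) = (\<lambda>i. - v i - of_bool (i \<in> D))"
        using d by auto
      moreover have "n = card (D - {d})" "finite (D - {d})" using Suc d by auto
      ultimately show ?thesis
        using Suc.hyps(1)[of "D - {d}" "\<lambda>l. H (l @ [\<lambda>i. - v i])" "v(d := v d + 1)"] by simp
    qed
    then show ?case
      using D by (subst cell_sum_step_last[of _ H]) (simp_all add: cell_sum_step)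
  qed simp
  from this[of H] show ?thesis by (simp only: assms(2))
qed

section \<open>Tucker's lemma\<close>

lemma alternating_iff_nth:
  "alternating s bs \<longleftrightarrow> (\<forall>i<length bs. bs ! i = (even i = s))"
proof (induction bs arbitrary: s)
  case (Cons b bs)
  show ?case
    by (cases s) (simp_all add: Cons.IH All_less_Suc2)
qed simp

lemma sort_rev: "sort (rev xs) = sort xs"
  by (rule properties_for_sort) simp_all

lemma sum_telescope_bit:
  fixes g :: "int \<Rightarrow> bit"
  assumes "a \<le> b"
  shows "(\<Sum>c\<in>{a..<b}. g (c + 1) + g c) = g b + g a"
  using assms
proof (induction b rule: int_ge_induct)
  case (step b)
  then have "{a..<b + 1} = insert b {a..<b}" by auto
  then have "(\<Sum>c\<in>{a..<b + 1}. g (c + 1) + g c) = g (b + 1) + (g b + (g b + g a))"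
    using step by (simp add: add.assoc)
  then show ?case by simp
qed simp

lemma cell_sum_0: "finite D \<Longrightarrow> cell_sum (\<lambda>l. 0) v D = 0"
  using cell_sum_add[of D "\<lambda>l. 0" "\<lambda>l. 0" v] by simp

definition box :: "nat \<Rightarrow> int \<Rightarrow> (nat \<Rightarrow> int) set" where
  "box n N = {v. (\<forall>i<n. \<bar>v i\<bar> \<le> N) \<and> (\<forall>i\<ge>n. v i = 0)}"

text \<open>A hypothetical counterexample to Tucker's lemma, to be refuted within this context:
  \<open>L_adjacent\<close> denies that any adjacent points carry opposite labels.\<close>

locale tucker_labelling =
  fixes n :: nat and N :: int and L :: "(nat \<Rightarrow> int) \<Rightarrow> nat"
  assumes N_pos: "N > 0"
    and L_less: "v \<in> box n N \<Longrightarrow> L v < 2 * n"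
    and L_antipode: "v \<in> box n N \<Longrightarrow> i < n \<Longrightarrow> \<bar>v i\<bar> = N \<Longrightarrow> L (\<lambda>i. - v i) = opp (L v)"
    and L_adjacent: "p \<in> box n N \<Longrightarrow> q \<in> box n N \<Longrightarrow> \<forall>i. \<bar>p i - q i\<bar> \<le> 1 \<Longrightarrow> L q \<noteq> opp (L p)"
begin

text \<open>
  A face of the cube is a sign vector \<open>\<sigma>\<close>: coordinate \<open>i\<close> is fixed to \<open>\<sigma> i * N\<close> if \<open>\<sigma> i \<noteq> 0\<close>, and free
  otherwise. The faces with \<open>m\<close> fixed coordinates whose signs alternate, beginning with \<open>+\<close>, form
  modulo 2 a hemisphere; its boundary consists of the faces with \<open>m + 1\<close> alternating signs, which
  is the next hemisphere together with its antipode.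
\<close>

definition faces :: "nat \<Rightarrow> (nat \<Rightarrow> int) set" where
  "faces m = {\<sigma>. (\<forall>i<n. \<sigma> i \<in> {-1, 0, 1}) \<and> (\<forall>i\<ge>n. \<sigma> i = 0) \<and> card {i. \<sigma> i \<noteq> 0} = m}"

definition free :: "(nat \<Rightarrow> int) \<Rightarrow> nat set" where
  "free \<sigma> = {i. i < n \<and> \<sigma> i = 0}"

definition verts :: "(nat \<Rightarrow> int) \<Rightarrow> (nat \<Rightarrow> int) set" where
  "verts \<sigma> = {v. (\<forall>i<n. if \<sigma> i = 0 then - N \<le> v i \<and> v i < N else v i = \<sigma> i * N) \<and> (\<forall>i\<ge>n. v i = 0)}"

definition label_cochain :: "bool \<Rightarrow> (nat \<Rightarrow> int) list \<Rightarrow> bit" where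
  "label_cochain s l = alt_cochain s (map L l)"

definition face_count :: "bool \<Rightarrow> (nat \<Rightarrow> int) \<Rightarrow> bit" where
  "face_count s \<sigma> = (\<Sum>v\<in>verts \<sigma>. cell_sum (label_cochain s) v (free \<sigma>))"

definition alt_face :: "bool \<Rightarrow> (nat \<Rightarrow> int) \<Rightarrow> bool" where
  "alt_face s \<sigma> \<longleftrightarrow> alternating s (map (\<lambda>i. \<sigma> i > 0) (sorted_list_of_set {i. \<sigma> i \<noteq> 0}))"

lemma finite_free [simp]: "finite (free \<sigma>)"
  by (simp add: free_def)

lemma support_less: "\<sigma> \<in> faces m \<Longrightarrow> \<sigma> i \<noteq> 0 \<Longrightarrow> i < n"
  by (rule ccontr) (simp add: faces_def)

lemma finite_support: "\<sigma> \<in> faces m \<Longrightarrow> finite {i. \<sigma> i \<noteq> 0}"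
  using support_less[of \<sigma> m] by (intro finite_subset[of "{i. \<sigma> i \<noteq> 0}" "{..<n}"]) auto

lemma finite_faces: "finite (faces m)"
proof (rule finite_subset)
  show "faces m \<subseteq> {\<sigma>. \<forall>i. (i \<in> {..<n} \<longrightarrow> \<sigma> i \<in> {-1, 0, 1}) \<and> (i \<notin> {..<n} \<longrightarrow> \<sigma> i = 0)}"
    by (auto simp: faces_def)
qed (intro finite_set_of_finite_funs, auto)

lemma cell_subset_box:
  assumes "v \<in> verts \<sigma>" "\<sigma> \<in> faces m"
  shows "cell v (free \<sigma>) \<subseteq> box n N"
proof
  fix p assume p: "p \<in> cell v (free \<sigma>)"
  have "\<bar>p i\<bar> \<le> N" if "i < n" for i
  proof -
    have "v i \<le> p i \<and> p i \<le> v i + of_bool (i \<in> free \<sigma>)" using p by (auto simp: cell_def)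
    moreover have "if \<sigma> i = 0 then - N \<le> v i \<and> v i < N else v i = \<sigma> i * N"
      using assms(1) that by (auto simp: verts_def)
    moreover have "\<sigma> i \<in> {-1, 0, 1}" using assms(2) that by (auto simp: faces_def)
    ultimately show ?thesis using that N_pos by (auto simp: free_def split: if_splits)
  qed
  moreover have "p i = 0" if "i \<ge> n" for i
  proof -
    have "v i \<le> p i \<and> p i \<le> v i + of_bool (i \<in> free \<sigma>)" using p by (auto simp: cell_def)
    moreover have "v i = 0" using assms(1) that by (auto simp: verts_def)
    ultimately show ?thesis using that by (auto simp: free_def)
  qed
  ultimately show "p \<in> box n N" by (auto simp: box_def)
qed

text \<open>Any two points of one grid cell differ by at most 1 in each coordinate, so
  \<open>L_adjacent\<close> applies to them.\<close>

lemma opp_notin_labels: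
  assumes "set l \<subseteq> cell v (free \<sigma>)" "v \<in> verts \<sigma>" "\<sigma> \<in> faces m"
  shows "\<forall>a\<in>set (map L l). opp a \<notin> set (map L l)"
proof -
  have "L q \<noteq> opp (L p)" if "p \<in> set l" "q \<in> set l" for p q
  proof (rule L_adjacent)
    have pq: "p \<in> cell v (free \<sigma>)" "q \<in> cell v (free \<sigma>)" using that assms by auto
    then show "p \<in> box n N" "q \<in> box n N" using cell_subset_box assms by blast+
    have "\<bar>p i - q i\<bar> \<le> 1" for i
    proof -
      have "v i \<le> p i" "p i \<le> v i + of_bool (i \<in> free \<sigma>)" "v i \<le> q i" "q i \<le> v i + of_bool (i \<in> free \<sigma>)"
        using pq by (auto simp: cell_def)
      then show ?thesis by (auto simp: of_bool_def split: if_splits)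
    qed
    then show "\<forall>i. \<bar>p i - q i\<bar> \<le> 1" by blast
  qed
  then show ?thesis by fastforce
qed

section \<open>Coboundary, boundary and antipode for the faces of the cube\<close>

lemma coboundary_label_cochain:
  "coboundary (label_cochain s) l = label_cochain s l + label_cochain (\<not> s) l"
proof -
  have "label_cochain s = (\<lambda>l. alt_cochain s (map L l))"
    by (auto simp: label_cochain_def)
  then show ?thesis
    by (simp add: coboundary_map coboundary_alt_cochain label_cochain_def)
qed

text \<open>The deletion identity for sign patterns: freeing coordinate \<open>d\<close> deletes one
  sign, so the left side counts the alternating faces that have \<sigma> as a facet.\<close>

lemma sum_alt_face_remove:
  assumes "finite {i. \<sigma> i \<noteq> 0}"
  shows "(\<Sum>d | \<sigma> d \<noteq> 0. of_bool (alt_face s (\<sigma>(d := 0)))) =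
         (of_bool (alt_face s \<sigma>) + of_bool (alt_face (\<not> s) \<sigma>) :: bit)"
proof -
  let ?A = "{i. \<sigma> i \<noteq> 0}"
  let ?xs = "sorted_list_of_set ?A"
  have "alt_face s (\<sigma>(d := 0)) \<longleftrightarrow> alternating s (map (\<lambda>i. \<sigma> i > 0) (remove1 d ?xs))" if "d \<in> ?A" for d
  proof -
    have "{i. (\<sigma>(d := 0)) i \<noteq> 0} = ?A - {d}" by auto
    then have "sorted_list_of_set {i. (\<sigma>(d := 0)) i \<noteq> 0} = remove1 d ?xs"
      using assms that by (simp add: sorted_list_of_set_remove)
    moreover have "map (\<lambda>i. (\<sigma>(d := 0)) i > 0) (remove1 d ?xs) = map (\<lambda>i. \<sigma> i > 0) (remove1 d ?xs)"
      by (intro map_cong refl) auto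
    ultimately show ?thesis by (simp only: alt_face_def)
  qed
  then have "(\<Sum>d\<in>?A. of_bool (alt_face s (\<sigma>(d := 0)))) =
    (\<Sum>d\<in>set ?xs. of_bool (alternating s (map (\<lambda>i. \<sigma> i > 0) (remove1 d ?xs))) :: bit)"
    using assms by (intro sum.cong) auto
  also have "\<dots> = (\<Sum>d\<leftarrow>?xs. of_bool (alternating s (map (\<lambda>i. \<sigma> i > 0) (remove1 d ?xs))))"
    by (subst sum_list_distinct_conv_sum_set) auto
  also have "\<dots> = of_bool (alt_face s \<sigma>) + of_bool (alt_face (\<not> s) \<sigma>)"
    unfolding alt_face_def by (intro sum_alternating_remove1) auto
  finally show ?thesis .
qed

text \<open>Consecutive cells in direction \<open>d\<close> share a facet, which is counted twice;
  only the two outermost layers survive.\<close>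

lemma sum_verts_telescope:
  assumes "d \<in> free \<sigma>"
  shows "(\<Sum>v\<in>verts \<sigma>. Q (v(d := v d + 1)) + Q v) =
    (\<Sum>v\<in>verts (\<sigma>(d := 1)). Q v) + (\<Sum>v\<in>verts (\<sigma>(d := - 1)). Q v :: bit)"
proof -
  have d: "d < n" "\<sigma> d = 0" using assms by (auto simp: free_def)
  define R where "R = {u. (\<forall>i<n. i \<noteq> d \<longrightarrow> (if \<sigma> i = 0 then - N \<le> u i \<and> u i < N else u i = \<sigma> i * N))
    \<and> (\<forall>i\<ge>n. u i = 0)}"
  have R: "u(d := c) \<in> R \<longleftrightarrow> u \<in> R" for u c
    using d by (simp add: R_def cong: imp_cong)
  have split: "(\<forall>i<n. P i) \<longleftrightarrow> P d \<and> (\<forall>i<n. i \<noteq> d \<longrightarrow> P i)" for P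
    using d by blast
  have verts: "verts \<sigma> = {u \<in> R. - N \<le> u d \<and> u d < N}"
    unfolding R_def verts_def by (subst split) (simp add: d conj_ac)
  have V: "verts (\<sigma>(d := c)) = {u \<in> R. u d = c * N}" if "c \<noteq> 0" for c
    unfolding R_def verts_def by (subst split) (simp add: that conj_ac cong: imp_cong)
  let ?V = "verts (\<sigma>(d := 1))"
  have "(\<Sum>v\<in>verts \<sigma>. Q (v(d := v d + 1)) + Q v) =
    (\<Sum>(u, c)\<in>?V \<times> {-N..<N}. Q (u(d := c + 1)) + Q (u(d := c)))"
    by (rule sum.reindex_bij_witness[of _ "\<lambda>(u, c). u(d := c)" "\<lambda>v. (v(d := N), v d)"])
       (auto simp: verts V R fun_upd_idem)
  also have "\<dots> = (\<Sum>u\<in>?V. \<Sum>c\<in>{-N..<N}. Q (u(d := c + 1)) + Q (u(d := c)))"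
    by (rule sum.cartesian_product[symmetric])
  also have "\<dots> = (\<Sum>u\<in>?V. Q (u(d := N)) + Q (u(d := - N)))"
    using N_pos by (intro sum.cong refl sum_telescope_bit[of "-N" N "\<lambda>c. Q (_(d := c))"]) auto
  also have "\<dots> = (\<Sum>u\<in>?V. Q u) + (\<Sum>u\<in>?V. Q (u(d := - N)))"
    unfolding sum.distrib by (auto simp: V fun_upd_idem)
  also have "(\<Sum>u\<in>?V. Q (u(d := - N))) = (\<Sum>v\<in>verts (\<sigma>(d := - 1)). Q v)"
    by (rule sum.reindex_bij_witness[of _ "\<lambda>u. u(d := N)" "\<lambda>u. u(d := - N)"])
       (auto simp: V R fun_upd_idem)
  finally show ?thesis .
qed

text \<open>Stokes' theorem on one face: the coboundary of the cochain yields both starting signs on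
  the face, and the inner facets of its grid cells cancel.\<close>

lemma face_count_boundary:
  assumes "free \<sigma> \<noteq> {}"
  shows "face_count True \<sigma> + face_count False \<sigma> =
    (\<Sum>d\<in>free \<sigma>. face_count True (\<sigma>(d := 1)) + face_count True (\<sigma>(d := - 1)))"
proof -
  let ?D = "free \<sigma>" and ?H = "label_cochain True"
  have fr: "free (\<sigma>(d := c)) = ?D - {d}" if "c \<noteq> 0" for c d
    using that by (auto simp: free_def)
  have "face_count True \<sigma> + face_count False \<sigma> = (\<Sum>v\<in>verts \<sigma>. cell_sum (coboundary ?H) v ?D)"
    by (simp add: face_count_def coboundary_label_cochain[abs_def] cell_sum_add sum.distrib)
  also have "\<dots> = (\<Sum>v\<in>verts \<sigma>. \<Sum>d\<in>?D. cell_sum ?H (v(d := v d + 1)) (?D - {d}) + cell_sum ?H v (?D - {d}))"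
    by (simp only: cell_sum_coboundary[OF finite_free assms])
  also have "\<dots> = (\<Sum>d\<in>?D. \<Sum>v\<in>verts \<sigma>. cell_sum ?H (v(d := v d + 1)) (?D - {d}) + cell_sum ?H v (?D - {d}))"
    by (rule sum.swap)
  also have "\<dots> = (\<Sum>d\<in>?D. face_count True (\<sigma>(d := 1)) + face_count True (\<sigma>(d := - 1)))"
    by (intro sum.cong refl, subst sum_verts_telescope) (simp_all add: face_count_def fr)
  finally show ?thesis .
qed

text \<open>The reflection carries the triangulation of the face to that of the antipodal face. A
  fixed coordinate puts the face on the boundary of the cube, so every label becomes its
  opposite.\<close>

lemma face_count_uminus:
  assumes "\<sigma> \<in> faces m" "m > 0"
  shows "face_count s (\<lambda>i. - \<sigma> i) = face_count (\<not> s) \<sigma>"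
proof -
  let ?D = "free \<sigma>"
  have fr: "free (\<lambda>i. - \<sigma> i) = ?D" by (auto simp: free_def)
  have "card {i. \<sigma> i \<noteq> 0} > 0" using assms by (simp add: faces_def)
  then obtain j where j: "\<sigma> j \<noteq> 0" by (auto simp: card_gt_0_iff)
  then have jn: "j < n" using assms support_less by blast
  \<comment> \<open>The lowest corner of a reflected cell is the reflection of the highest corner;
    hence the shift by 1 in the free directions.\<close>
  have "face_count s (\<lambda>i. - \<sigma> i) =
    (\<Sum>v\<in>verts \<sigma>. cell_sum (label_cochain s) (\<lambda>i. - v i - of_bool (i \<in> ?D)) ?D)"
    unfolding face_count_def fr
    by (rule sum.reindex_bij_witness[of _ "\<lambda>v i. - v i - of_bool (i \<in> ?D)" "\<lambda>v i. - v i - of_bool (i \<in> ?D)"])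
       (auto simp: verts_def free_def)
  also have "\<dots> = (\<Sum>v\<in>verts \<sigma>. cell_sum (\<lambda>l. label_cochain s (map (\<lambda>p i. - p i) l)) v ?D)"
    by (intro sum.cong refl cell_sum_antipode[symmetric])
       (simp_all add: label_cochain_def alt_cochain_def rev_map[symmetric] sort_rev)
  also have "\<dots> = (\<Sum>v\<in>verts \<sigma>. cell_sum (label_cochain (\<not> s)) v ?D)"
  proof (intro sum.cong refl cell_sum_cong finite_free)
    fix v l assume v: "v \<in> verts \<sigma>" and l: "set l \<subseteq> cell v ?D"
    have "L (\<lambda>i. - p i) = opp (L p)" if "p \<in> set l" for p
    proof (rule L_antipode[OF _ jn])
      show "p \<in> box n N" using cell_subset_box[OF v assms(1)] l that by auto
      have "p j = v j" using l that j by (auto simp: cell_def free_def subset_iff dest!: bspec[of _ _ p] spec[of _ j])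
      also have "v j = \<sigma> j * N" using v j jn by (auto simp: verts_def)
      finally show "\<bar>p j\<bar> = N"
        using assms(1) j jn N_pos by (auto simp: faces_def dest!: spec[of _ j])
    qed
    then have "map L (map (\<lambda>p i. - p i) l) = map opp (map L l)" by simp
    then show "label_cochain s (map (\<lambda>p i. - p i) l) = label_cochain (\<not> s) l"
      using alt_cochain_opp[OF opp_notin_labels[OF l v assms(1)], of s] by (simp only: label_cochain_def)
  qed
  finally show ?thesis by (simp add: face_count_def)
qed

text \<open>The number, modulo 2, of simplices in the hemisphere of codimension \<open>m\<close>
  whose labels alternate, with either first sign.\<close>

definition alt_count :: "nat \<Rightarrow> bit" where
  "alt_count m = (\<Sum>\<sigma>\<in>faces m. of_bool (alt_face True \<sigma>) * (face_count True \<sigma> + face_count False \<sigma>))"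

lemma alt_face_uminus:
  assumes "finite {i. \<sigma> i \<noteq> 0}"
  shows "alt_face s (\<lambda>i. - \<sigma> i) = alt_face (\<not> s) \<sigma>"
proof -
  have "map (\<lambda>i. - \<sigma> i > 0) (sorted_list_of_set {i. \<sigma> i \<noteq> 0}) =
        map Not (map (\<lambda>i. \<sigma> i > 0) (sorted_list_of_set {i. \<sigma> i \<noteq> 0}))"
    using assms by auto
  then have "alternating s (map (\<lambda>i. - \<sigma> i > 0) (sorted_list_of_set {i. \<sigma> i \<noteq> 0})) =
        alternating (\<not> s) (map (\<lambda>i. \<sigma> i > 0) (sorted_list_of_set {i. \<sigma> i \<noteq> 0}))"
    by (simp only: alternating_map_Not)
  then show ?thesis by (simp add: alt_face_def)
qed

text \<open>Summing the boundary formula over a hemisphere and regrouping by facets weights each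
  facet by its number of alternating cofaces. By the deletion identity the weights select the next
  hemisphere and its antipode; reflecting the antipodal part turns label lists that start with +
  into lists that start with -.\<close>

lemma alt_count_Suc:
  assumes "m < n"
  shows "alt_count m = alt_count (Suc m)"
proof -
  let ?W = "face_count True"
  have free_ne: "free \<sigma> \<noteq> {}" if "\<sigma> \<in> faces m" for \<sigma>
  proof
    assume "free \<sigma> = {}"
    then have "{..<n} \<subseteq> {i. \<sigma> i \<noteq> 0}" by (auto simp: free_def)
    then have "n \<le> card {i. \<sigma> i \<noteq> 0}" using finite_support[OF that] by (metis card_lessThan card_mono)
    then show False using that assms by (auto simp: faces_def)
  qed
  have "alt_count m = (\<Sum>\<sigma>\<in>faces m. \<Sum>d\<in>free \<sigma>. of_bool (alt_face True \<sigma>) * (?W (\<sigma>(d := 1)) + ?W (\<sigma>(d := - 1))))"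
    unfolding alt_count_def
    by (intro sum.cong refl) (simp only: face_count_boundary[OF free_ne] sum_distrib_left)
  also have "\<dots> = (\<Sum>\<sigma>\<in>faces m. \<Sum>(d, c)\<in>free \<sigma> \<times> {1, - 1}. of_bool (alt_face True \<sigma>) * ?W (\<sigma>(d := c)))"
    by (intro sum.cong refl, subst sum.cartesian_product[symmetric]) (simp add: distrib_left)
  also have "\<dots> = (\<Sum>(\<sigma>, d, c)\<in>Sigma (faces m) (\<lambda>\<sigma>. free \<sigma> \<times> {1, - 1}). of_bool (alt_face True \<sigma>) * ?W (\<sigma>(d := c)))"
    by (subst sum.Sigma) (auto simp: finite_faces case_prod_unfold)
  also have "\<dots> = (\<Sum>(\<tau>, d)\<in>Sigma (faces (Suc m)) (\<lambda>\<tau>. {d. \<tau> d \<noteq> 0}). of_bool (alt_face True (\<tau>(d := 0))) * ?W \<tau>)"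
  proof (rule sum.reindex_bij_witness[of _ "\<lambda>(\<tau>, d). (\<tau>(d := 0), d, \<tau> d)" "\<lambda>(\<sigma>, d, c). (\<sigma>(d := c), d)"], goal_cases)
    case (2 x)
    then obtain \<sigma> d c where x: "x = (\<sigma>, d, c)" "\<sigma> \<in> faces m" "d \<in> free \<sigma>" "c = 1 \<or> c = - 1" by auto
    then have "{i. (\<sigma>(d := c)) i \<noteq> 0} = insert d {i. \<sigma> i \<noteq> 0}" by auto
    then have "card {i. (\<sigma>(d := c)) i \<noteq> 0} = Suc m"
      using x finite_support[of \<sigma> m] by (auto simp: free_def faces_def)
    with x show ?case by (auto simp: faces_def free_def)
  next
    case (4 x)
    then obtain \<tau> d where x: "x = (\<tau>, d)" "\<tau> \<in> faces (Suc m)" "\<tau> d \<noteq> 0" by auto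
    then have "{i. (\<tau>(d := 0)) i \<noteq> 0} = {i. \<tau> i \<noteq> 0} - {d}" by auto
    then have "card {i. (\<tau>(d := 0)) i \<noteq> 0} = m"
      using x finite_support[of \<tau> "Suc m"] by (simp add: faces_def)
    moreover have "d < n" using x support_less by blast
    moreover have "\<tau> d = 1 \<or> \<tau> d = - 1" using x \<open>d < n\<close> by (auto simp: faces_def)
    ultimately show ?case using x by (auto simp: faces_def free_def)
  qed (auto simp: free_def fun_upd_idem)
  also have "\<dots> = (\<Sum>\<tau>\<in>faces (Suc m). \<Sum>d | \<tau> d \<noteq> 0. of_bool (alt_face True (\<tau>(d := 0))) * ?W \<tau>)"
    by (subst sum.Sigma) (auto simp: finite_faces finite_support[where m = "Suc m"])
  also have "\<dots> = (\<Sum>\<tau>\<in>faces (Suc m). (of_bool (alt_face True \<tau>) + of_bool (alt_face False \<tau>)) * ?W \<tau>)"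
    by (intro sum.cong refl)
       (simp only: sum_alt_face_remove[OF finite_support] not_True_eq_False flip: sum_distrib_right)
  also have "\<dots> = (\<Sum>\<tau>\<in>faces (Suc m). of_bool (alt_face True \<tau>) * ?W \<tau>) +
                  (\<Sum>\<tau>\<in>faces (Suc m). of_bool (alt_face False \<tau>) * ?W \<tau>)"
    by (simp add: distrib_right sum.distrib)
  also have "(\<Sum>\<tau>\<in>faces (Suc m). of_bool (alt_face False \<tau>) * ?W \<tau>) =
             (\<Sum>\<tau>\<in>faces (Suc m). of_bool (alt_face True \<tau>) * face_count False \<tau>)"
  proof (rule sum.reindex_bij_witness[of _ "\<lambda>\<tau> i. - \<tau> i" "\<lambda>\<tau> i. - \<tau> i"], goal_cases)
    case (5 \<tau>)
    then show ?case
      using face_count_uminus[of \<tau> "Suc m" False] alt_face_uminus[OF finite_support[of \<tau> "Suc m"], of True]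
      by simp
  qed (auto simp: faces_def)
  finally show ?thesis by (simp add: alt_count_def distrib_left sum.distrib)
qed

text \<open>A simplex of full dimension has n + 1 labels, while an alternating list without opposite
  labels has at most n.\<close>

lemma alt_count_0: "alt_count 0 = 0"
proof -
  have "face_count s \<sigma> = 0" if \<sigma>: "\<sigma> \<in> faces 0" for s \<sigma>
    unfolding face_count_def
  proof (rule sum.neutral, rule ballI)
    fix v assume v: "v \<in> verts \<sigma>"
    have "free \<sigma> = {..<n}" using finite_support[OF \<sigma>] \<sigma> by (auto simp: free_def faces_def)
    then have D: "card (free \<sigma>) = n" by simp
    have "cell_sum (label_cochain s) v (free \<sigma>) = cell_sum (\<lambda>l. 0) v (free \<sigma>)"
    proof (rule cell_sum_cong[OF finite_free])
      fix l assume l: "set l \<subseteq> cell v (free \<sigma>)" "length l = Suc (card (free \<sigma>))"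
      then have "set l \<subseteq> box n N" using cell_subset_box[OF v \<sigma>] by blast
      then show "label_cochain s l = 0"
        unfolding label_cochain_def
        using opp_notin_labels[OF l(1) v \<sigma>] l(2) D L_less by (intro alt_cochain_eq_0) auto
    qed
    then show "cell_sum (label_cochain s) v (free \<sigma>) = 0" by (simp add: cell_sum_0)
  qed
  then show ?thesis by (simp add: alt_count_def)
qed

text \<open>Only one face qualifies, a vertex of the cube, and a single label alternates for exactly
  one of the two starting signs.\<close>

lemma alt_count_n: "alt_count n = 1"
proof -
  define \<sigma>\<^sub>0 :: "nat \<Rightarrow> int" where "\<sigma>\<^sub>0 = (\<lambda>i. if i < n then if even i then 1 else - 1 else 0)"
  have support: "{i. \<sigma> i \<noteq> 0} = {..<n}" if "\<sigma> \<in> faces n" for \<sigma>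
  proof (rule card_subset_eq)
    show "{i. \<sigma> i \<noteq> 0} \<subseteq> {..<n}" using that support_less by blast
  qed (use that in \<open>auto simp: faces_def\<close>)
  have alt: "alt_face True \<sigma> \<longleftrightarrow> \<sigma> = \<sigma>\<^sub>0" if "\<sigma> \<in> faces n" for \<sigma>
  proof -
    have signs: "\<sigma> i = 1 \<or> \<sigma> i = - 1" if "i < n" for i
    proof -
      have "\<sigma> i \<noteq> 0" using support[OF \<open>\<sigma> \<in> faces n\<close>] that by blast
      then show ?thesis using \<open>\<sigma> \<in> faces n\<close> that by (simp add: faces_def) blast
    qed
    have "sorted_list_of_set {i. \<sigma> i \<noteq> 0} = [0..<n]"
      using sorted_list_of_set_range[of 0 n] support[OF that] by (simp only: atLeast0LessThan)
    then have "alt_face True \<sigma> \<longleftrightarrow> (\<forall>i<n. \<sigma> i > 0 \<longleftrightarrow> even i)"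
      by (simp add: alt_face_def alternating_iff_nth)
    also have "\<dots> \<longleftrightarrow> (\<forall>i<n. \<sigma> i = \<sigma>\<^sub>0 i)"
    proof (intro all_cong1 imp_cong refl)
      fix i assume "i < n"
      then show "(\<sigma> i > 0 \<longleftrightarrow> even i) \<longleftrightarrow> \<sigma> i = \<sigma>\<^sub>0 i"
        using signs[of i] by (simp add: \<sigma>\<^sub>0_def) linarith
    qed
    also have "\<dots> \<longleftrightarrow> \<sigma> = \<sigma>\<^sub>0"
    proof -
      have "\<forall>i. \<not> i < n \<longrightarrow> \<sigma> i = \<sigma>\<^sub>0 i"
        using that by (simp add: faces_def \<sigma>\<^sub>0_def)
      then show ?thesis unfolding fun_eq_iff by blast
    qed
    finally show ?thesis .
  qed
  have \<sigma>\<^sub>0: "\<sigma>\<^sub>0 \<in> faces n"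
  proof -
    have "{i. \<sigma>\<^sub>0 i \<noteq> 0} = {..<n}" by (auto simp: \<sigma>\<^sub>0_def)
    then show ?thesis by (auto simp: faces_def \<sigma>\<^sub>0_def)
  qed
  have "face_count True \<sigma>\<^sub>0 + face_count False \<sigma>\<^sub>0 = 1"
  proof -
    have "free \<sigma>\<^sub>0 = {}" by (auto simp: free_def \<sigma>\<^sub>0_def)
    moreover have "verts \<sigma>\<^sub>0 = {\<lambda>i. \<sigma>\<^sub>0 i * N}"
    proof -
      have "v \<in> verts \<sigma>\<^sub>0 \<longleftrightarrow> (\<forall>i<n. v i = \<sigma>\<^sub>0 i * N) \<and> (\<forall>i. \<not> i < n \<longrightarrow> v i = \<sigma>\<^sub>0 i * N)" for v
        by (simp add: verts_def \<sigma>\<^sub>0_def not_less cong: imp_cong)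
      then show ?thesis unfolding set_eq_iff singleton_iff fun_eq_iff by blast
    qed
    ultimately show ?thesis
      by (simp add: face_count_def label_cochain_def alt_cochain_def del: sum_of_bool_eq)
  qed
  then have "alt_count n = (\<Sum>\<sigma>\<in>faces n. if \<sigma> = \<sigma>\<^sub>0 then 1 else 0)"
    unfolding alt_count_def by (intro sum.cong refl) (auto simp: alt)
  also have "\<dots> = 1" using \<sigma>\<^sub>0 by (simp add: finite_faces)
  finally show ?thesis .
qed

lemma labelling_impossible: False
proof -
  have "m \<le> n \<Longrightarrow> alt_count m = 0" for m
    by (induction m) (auto simp: alt_count_0 simp flip: alt_count_Suc)
  from this[of n] show False by (simp add: alt_count_n)
qed

end

theorem tucker_lemma:
  fixes L :: "(nat \<Rightarrow> int) \<Rightarrow> nat"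
  assumes "N > 0" "\<And>v. v \<in> box n N \<Longrightarrow> L v < 2 * n"
    and "\<And>v i. v \<in> box n N \<Longrightarrow> i < n \<Longrightarrow> \<bar>v i\<bar> = N \<Longrightarrow> L (\<lambda>i. - v i) = opp (L v)"
  obtains p q where "p \<in> box n N" "q \<in> box n N" "\<forall>i. \<bar>p i - q i\<bar> \<le> 1" "L q = opp (L p)"
proof (rule ccontr)
  assume "\<not> thesis"
  with assms that have "tucker_labelling n N L"
    by unfold_locales blast+
  then show False by (rule tucker_labelling.labelling_impossible)
qed

section \<open>The Borsuk--Ulam theorem\<close>

text \<open>The distance on functions sums the coordinate distances, cut off at 1, with the powers
  of 1/2 as weights; the factor 2 is the geometric series.\<close>

lemma dist_fun_le:
  fixes x y :: "nat \<Rightarrow> real"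
  assumes "\<And>i. \<bar>x i - y i\<bar> \<le> c"
  shows "dist x y \<le> 2 * c"
proof -
  have sums: "(\<lambda>n. (1 / 2) ^ n * c) sums (2 * c)"
    using sums_mult2[OF geometric_sums[of "1 / 2 :: real"], of c] by simp
  have le: "(1 / 2) ^ n * min (dist (x (from_nat n)) (y (from_nat n))) 1 \<le> (1 / 2) ^ n * c" for n
    using assms[of "from_nat n"] by (intro mult_left_mono) (auto simp: dist_real_def)
  have "summable (\<lambda>n. (1 / 2) ^ n * min (dist (x (from_nat n)) (y (from_nat n))) 1)"
    using le by (intro summable_comparison_test'[OF sums_summable[OF sums], of 0]) auto
  then have "dist x y \<le> (\<Sum>n. (1 / 2) ^ n * c)"
    unfolding dist_fun_def using le sums_summable[OF sums] by (intro suminf_le) auto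
  then show ?thesis using sums_unique[OF sums] by simp
qed

section \<open>Compact cubes and a chart of the octahedral sphere\<close>

lemma compact_Pi_UNIV:
  fixes K :: "'a \<Rightarrow> 'b::topological_space set"
  assumes "\<And>i. compact (K i)"
  shows "compact (Pi UNIV K)"
proof -
  have "compactin (product_topology (\<lambda>i. euclidean) UNIV) (PiE UNIV K)"
    using assms by (simp add: compactin_PiE)
  then show ?thesis by (simp add: euclidean_product_topology PiE_UNIV_domain)
qed

text \<open>The index is the dimension of the sphere, so there are n + 1 coordinates.\<close>

definition octahedral_sphere :: "nat \<Rightarrow> (nat \<Rightarrow> real) set" where
  "octahedral_sphere n = {t. (\<forall>i>n. t i = 0) \<and> (\<Sum>i\<le>n. \<bar>t i\<bar>) = 1}"

definition real_box :: "nat \<Rightarrow> (nat \<Rightarrow> real) set" where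
  "real_box n = Pi UNIV (\<lambda>i. if i < n then {-1..1} else {0})"

lemma compact_real_box: "compact (real_box n)"
  unfolding real_box_def by (rule compact_Pi_UNIV) auto

lemma mem_real_box: "y \<in> real_box n \<longleftrightarrow> (\<forall>i<n. \<bar>y i\<bar> \<le> 1) \<and> (\<forall>i\<ge>n. y i = 0)"
proof -
  have "y i \<in> (if i < n then {-1..1} else {0}) \<longleftrightarrow> (i < n \<longrightarrow> \<bar>y i\<bar> \<le> 1) \<and> (i \<ge> n \<longrightarrow> y i = 0)" for i
    by (auto simp: abs_le_iff)
  then show ?thesis unfolding real_box_def Pi_iff by (simp only:) blast
qed

text \<open>The last coordinate vanishes exactly on the boundary of the cube.\<close>

definition hemisphere_chart :: "nat \<Rightarrow> (nat \<Rightarrow> real) \<Rightarrow> nat \<Rightarrow> real" where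
  "hemisphere_chart n y i =
     (if i < n then y i else if i = n then \<Prod>j<n. 1 - (y j)\<^sup>2 else 0)"

definition normalized_chart :: "nat \<Rightarrow> (nat \<Rightarrow> real) \<Rightarrow> nat \<Rightarrow> real" where
  "normalized_chart n y i = hemisphere_chart n y i / (\<Sum>j\<le>n. \<bar>hemisphere_chart n y j\<bar>)"

text \<open>Either some coordinate of \<open>y\<close> is nonzero or the product in the last
  coordinate is 1, so normalising never divides by 0.\<close>

lemma sum_chart_pos: "(\<Sum>j\<le>n. \<bar>hemisphere_chart n y j\<bar>) > 0"
proof -
  have "\<exists>j\<le>n. hemisphere_chart n y j \<noteq> 0"
  proof (rule ccontr)
    assume "\<not> ?thesis"
    then have z: "hemisphere_chart n y j = 0" if "j \<le> n" for j using that by blast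
    have "y j = 0" if "j < n" for j using z[of j] that by (simp add: hemisphere_chart_def)
    then have "hemisphere_chart n y n = 1" by (simp add: hemisphere_chart_def)
    then show False using z[of n] by simp
  qed
  then obtain j where "j \<in> {..n}" "hemisphere_chart n y j \<noteq> 0" by auto
  then show ?thesis by (intro sum_pos2[of _ j]) auto
qed

lemma normalized_chart_mem: "normalized_chart n y \<in> octahedral_sphere n"
proof -
  have "(\<Sum>i\<le>n. \<bar>normalized_chart n y i\<bar>) = 1"
    using sum_chart_pos[of n y]
    by (simp add: normalized_chart_def abs_divide flip: sum_divide_distrib)
  then show ?thesis
    by (simp add: octahedral_sphere_def normalized_chart_def hemisphere_chart_def)
qed

lemma continuous_on_normalized_chart: "continuous_on A (normalized_chart n)"
proof -
  have coord: "continuous_on A (\<lambda>y. y j :: real)" for j :: nat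
    by (rule continuous_on_subset[OF continuous_on_product_coordinates]) simp
  have "continuous_on A (\<lambda>y. hemisphere_chart n y i)" for i
    unfolding hemisphere_chart_def
    by (cases "i < n"; cases "i = n")
       (simp_all add: coord continuous_on_prod continuous_on_diff continuous_on_power)
  then have "continuous_on A (\<lambda>y. normalized_chart n y i)" for i
    unfolding normalized_chart_def using sum_chart_pos[of n]
    by (intro continuous_intros) (auto simp: less_imp_neq[symmetric])
  then show ?thesis
    by (intro continuous_on_coordinatewise_then_product)
qed

text \<open>On the boundary of the cube the last coordinate, which is even in \<open>y\<close>,
  vanishes, and the others are odd. This makes a transported odd map antipodal on that
  boundary.\<close>

lemma normalized_chart_uminus:
  assumes "j < n" "\<bar>y j\<bar> = 1"
  shows "normalized_chart n (\<lambda>i. - y i) = (\<lambda>i. - normalized_chart n y i)"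
proof -
  have "(y j)\<^sup>2 = 1" using assms(2) by (metis one_power2 power2_abs)
  then have "(\<Prod>j<n. 1 - (y j)\<^sup>2) = 0"
    using assms(1) by (intro prod_zero) auto
  then have "hemisphere_chart n (\<lambda>i. - y i) = (\<lambda>i. - hemisphere_chart n y i)"
    by (simp add: hemisphere_chart_def fun_eq_iff)
  then show ?thesis by (simp add: normalized_chart_def fun_eq_iff)
qed

lemma finite_uniform_modulus:
  fixes F :: "'a::metric_space \<Rightarrow> nat \<Rightarrow> real"
  assumes "compact K" "\<And>i. i < n \<Longrightarrow> continuous_on K (\<lambda>y. F y i)" "\<epsilon> > 0"
  obtains \<delta> where "\<delta> > 0"
    "\<And>x y i. x \<in> K \<Longrightarrow> y \<in> K \<Longrightarrow> dist x y < \<delta> \<Longrightarrow> i < n \<Longrightarrow> \<bar>F x i - F y i\<bar> < \<epsilon>"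
proof -
  have "\<exists>d>0. \<forall>x\<in>K. \<forall>y\<in>K. dist x y < d \<longrightarrow> \<bar>F x i - F y i\<bar> < \<epsilon>" if "i < n" for i
    using compact_uniformly_continuous[OF assms(2)[OF that] assms(1)] assms(3)
    unfolding uniformly_continuous_on_def dist_real_def by (metis abs_minus_commute)
  then obtain d where d: "\<And>i. i < n \<Longrightarrow> d i > 0 \<and> (\<forall>x\<in>K. \<forall>y\<in>K. dist x y < d i \<longrightarrow> \<bar>F x i - F y i\<bar> < \<epsilon>)"
    by metis
  \<comment> \<open>The extra element 1 keeps the set nonempty when \<open>n = 0\<close>.\<close>
  define \<delta> where "\<delta> = Min (insert 1 (d ` {..<n}))"
  have "\<delta> > 0" "\<And>i. i < n \<Longrightarrow> \<delta> \<le> d i"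
    using d by (auto simp: \<delta>_def)
  with d show thesis by (intro that[of \<delta>]) (auto, fastforce)
qed

text \<open>Without a zero, a fine grid can be labelled by the first large coordinate of the
  transported map together with its sign. An edge with opposite labels, which Tucker's lemma
  provides, is a jump of at least 2 \<epsilon> where the modulus of continuity allows less than
  \<epsilon>.\<close>

theorem borsuk_ulam:
  fixes G :: "(nat \<Rightarrow> real) \<Rightarrow> nat \<Rightarrow> real"
  assumes cont: "\<And>i. i < n \<Longrightarrow> continuous_on (octahedral_sphere n) (\<lambda>t. G t i)"
    and G_odd: "\<And>t i. t \<in> octahedral_sphere n \<Longrightarrow> i < n \<Longrightarrow> G (\<lambda>j. - t j) i = - G t i"
  shows "\<exists>t\<in>octahedral_sphere n. \<forall>i<n. G t i = 0"
proof (rule ccontr)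
  assume no_zero: "\<not> ?thesis"
  define F where "F = (\<lambda>y. G (normalized_chart n y))"
  have F_cont: "continuous_on (real_box n) (\<lambda>y. F y i)" if "i < n" for i
    unfolding F_def
    by (rule continuous_on_compose2[OF cont[OF that] continuous_on_normalized_chart])
       (auto simp: normalized_chart_mem)
  have F_nz: "\<exists>i<n. F y i \<noteq> 0" for y
    using no_zero normalized_chart_mem unfolding F_def by blast
  then have n: "n > 0" by fastforce
  have "continuous_on (real_box n) (\<lambda>y. \<Sum>i<n. \<bar>F y i\<bar>)"
    by (intro continuous_intros F_cont) auto
  moreover have "(\<lambda>i. 0) \<in> real_box n" by (simp add: mem_real_box)
  ultimately obtain y\<^sub>0 where y\<^sub>0: "\<And>y. y \<in> real_box n \<Longrightarrow> (\<Sum>i<n. \<bar>F y\<^sub>0 i\<bar>) \<le> (\<Sum>i<n. \<bar>F y i\<bar>)"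
    using continuous_attains_inf[OF compact_real_box] by blast
  \<comment> \<open>The minimal l1 norm divided by \<open>n\<close>: at every point of the cube some
    coordinate is at least this large in absolute value.\<close>
  define \<epsilon> where "\<epsilon> = (\<Sum>i<n. \<bar>F y\<^sub>0 i\<bar>) / n"
  obtain j where "j < n" "F y\<^sub>0 j \<noteq> 0" using F_nz by blast
  then have "(\<Sum>i<n. \<bar>F y\<^sub>0 i\<bar>) > 0" by (intro sum_pos2[of _ j]) auto
  then have \<epsilon>: "\<epsilon> > 0" using n by (simp add: \<epsilon>_def)
  have large: "\<exists>i<n. \<epsilon> \<le> \<bar>F y i\<bar>" if "y \<in> real_box n" for y
  proof (rule ccontr)
    assume "\<not> ?thesis"
    then have "(\<Sum>i<n. \<bar>F y i\<bar>) < (\<Sum>i<n. \<epsilon>)"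
      using n by (intro sum_strict_mono) auto
    then show False using y\<^sub>0[OF that] n by (simp add: \<epsilon>_def)
  qed
  obtain \<delta> where \<delta>: "\<delta> > 0"
    "\<And>x y i. x \<in> real_box n \<Longrightarrow> y \<in> real_box n \<Longrightarrow> dist x y < \<delta> \<Longrightarrow> i < n \<Longrightarrow> \<bar>F x i - F y i\<bar> < \<epsilon>"
    using finite_uniform_modulus[where F = F, OF compact_real_box F_cont \<epsilon>] by metis
  \<comment> \<open>Neighbouring grid points differ by at most 1/M in each coordinate, hence by at
    most 2/M in the metric on functions.\<close>
  obtain M :: nat where M: "M > 0" "2 / real M < \<delta>"
  proof -
    obtain M :: nat where "2 / \<delta> < real M" using reals_Archimedean2 by blast
    moreover have "0 < 2 / \<delta>" using \<delta>(1) by simp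
    ultimately have "0 < real M" by linarith
    then show thesis using that[of M] \<open>2 / \<delta> < real M\<close> \<delta>(1) by (simp add: field_simps)
  qed
  define \<gamma> where "\<gamma> = (\<lambda>(v :: nat \<Rightarrow> int) i. real_of_int (v i) / real M)"
  have \<gamma>: "\<gamma> v \<in> real_box n" if "v \<in> box n (int M)" for v
    unfolding mem_real_box
  proof (intro conjI allI impI)
    fix i assume "i < n"
    then have "\<bar>v i\<bar> \<le> int M" using that by (auto simp: box_def)
    then have "\<bar>real_of_int (v i)\<bar> \<le> real M" by linarith
    then show "\<bar>\<gamma> v i\<bar> \<le> 1" using M by (simp add: \<gamma>_def)
  next
    fix i assume "n \<le> i"
    then show "\<gamma> v i = 0" using that by (simp add: box_def \<gamma>_def)
  qed
  define idx where "idx = (\<lambda>v. LEAST i. i < n \<and> \<epsilon> \<le> \<bar>F (\<gamma> v) i\<bar>)"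
  have idx: "idx v < n" "\<epsilon> \<le> \<bar>F (\<gamma> v) (idx v)\<bar>" if "v \<in> box n (int M)" for v
    using LeastI_ex[of "\<lambda>i. i < n \<and> \<epsilon> \<le> \<bar>F (\<gamma> v) i\<bar>"] large[OF \<gamma>[OF that]] by (auto simp: idx_def)
  define L where "L = (\<lambda>v. 2 * idx v + of_bool (F (\<gamma> v) (idx v) < 0))"
  obtain p q where pq: "p \<in> box n (int M)" "q \<in> box n (int M)" "\<forall>i. \<bar>p i - q i\<bar> \<le> 1" "L q = opp (L p)"
  proof (rule tucker_lemma[of "int M" n L])
    show "int M > 0" using M by simp
    show "L v < 2 * n" if "v \<in> box n (int M)" for v
      using idx(1)[OF that] by (simp add: L_def of_bool_def)
    show "L (\<lambda>i. - v i) = opp (L v)" if v: "v \<in> box n (int M)" and i: "i < n" "\<bar>v i\<bar> = int M" for v i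
    proof -
      have "\<bar>real_of_int (v i)\<bar> = real M" using i(2) by linarith
      then have "\<bar>\<gamma> v i\<bar> = 1" using M by (simp add: \<gamma>_def)
      moreover have "\<gamma> (\<lambda>i. - v i) = (\<lambda>i. - \<gamma> v i)" by (simp add: \<gamma>_def)
      ultimately have F_neg: "F (\<gamma> (\<lambda>i. - v i)) k = - F (\<gamma> v) k" if "k < n" for k
        using that i(1) G_odd normalized_chart_mem by (simp add: F_def normalized_chart_uminus)
      then have "idx (\<lambda>i. - v i) = idx v"
        unfolding idx_def by (intro arg_cong[where f = Least] ext) auto
      then show ?thesis
        using F_neg[OF idx(1)[OF v]] idx(2)[OF v] \<epsilon> by (auto simp: L_def opp_def)
    qed
  qed blast
  have "L q div 2 = L p div 2" using pq(4) by (simp add: opp_div_2)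
  then have "idx q = idx p" by (simp add: L_def of_bool_def split: if_splits)
  moreover have "even (L q) \<longleftrightarrow> odd (L p)" using pq(4) by (simp add: even_opp)
  ultimately have "\<epsilon> + \<epsilon> \<le> \<bar>F (\<gamma> p) (idx p) - F (\<gamma> q) (idx p)\<bar>"
    using idx(2)[OF pq(1)] idx(2)[OF pq(2)] by (auto simp: L_def of_bool_def split: if_splits)
  moreover have "dist (\<gamma> p) (\<gamma> q) < \<delta>"
  proof -
    have "\<bar>\<gamma> p i - \<gamma> q i\<bar> \<le> 1 / real M" for i
    proof -
      have "\<bar>p i - q i\<bar> \<le> 1" using pq(3) by blast
      then have "\<bar>real_of_int (p i) - real_of_int (q i)\<bar> \<le> 1" by linarith
      then show ?thesis
        using M by (simp add: \<gamma>_def divide_right_mono flip: diff_divide_distrib)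
    qed
    then show ?thesis using dist_fun_le[of "\<gamma> p" "\<gamma> q"] M(2) by fastforce
  qed
  then have "\<bar>F (\<gamma> p) (idx p) - F (\<gamma> q) (idx p)\<bar> < \<epsilon>"
    using \<delta>(2) \<gamma> pq idx(1) by blast
  ultimately show False using \<epsilon> by linarith
qed

lemma compact_octahedral_sphere: "compact (octahedral_sphere n)"
proof -
  have coord: "continuous_on UNIV (\<lambda>y. y j :: real)" for j :: nat
    by (rule continuous_on_product_coordinates)
  have "closed {t :: nat \<Rightarrow> real. (\<Sum>i\<le>n. \<bar>t i\<bar>) = 1}"
    by (intro closed_Collect_eq continuous_on_sum continuous_on_rabs coord continuous_on_const)
  moreover have "octahedral_sphere n = real_box (Suc n) \<inter> {t. (\<Sum>i\<le>n. \<bar>t i\<bar>) = 1}"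
  proof -
    have "\<bar>t j\<bar> \<le> 1" if "j < Suc n" "(\<Sum>i\<le>n. \<bar>t i\<bar>) = 1" for t :: "nat \<Rightarrow> real" and j
      using member_le_sum[of j "{..n}" "\<lambda>i. \<bar>t i\<bar>"] that by auto
    then show ?thesis by (auto simp: octahedral_sphere_def mem_real_box Suc_le_eq)
  qed
  ultimately show ?thesis using compact_Int_closed[OF compact_real_box] by simp
qed

lemma uminus_mem_octahedral_sphere: "t \<in> octahedral_sphere n \<Longrightarrow> (\<lambda>i. - t i) \<in> octahedral_sphere n"
  by (simp add: octahedral_sphere_def)

section \<open>Genus and the minimax values\<close>

lemma genus_empty: "genus {} = 0"
proof -
  have "genus ({} :: 'a set) \<le> enat 0"
    unfolding genus_def
    by (intro Inf_lower CollectI exI[of _ 0] exI[of _ "\<lambda>_ _. 0"]) (auto simp: continuous_map_const topspace_Euclidean_space)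
  then show ?thesis by (simp add: zero_enat_def[symmetric])
qed

text \<open>An odd map without zeros into dimension m \<le> n, read as a map with n coordinates of
  which those from \<open>m\<close> on vanish, contradicts the Borsuk-Ulam theorem.\<close>

lemma genus_odd_image_octahedral_sphere:
  fixes \<Phi> :: "(nat \<Rightarrow> real) \<Rightarrow> 'a::real_normed_vector"
  assumes cont: "continuous_on (octahedral_sphere n) \<Phi>"
    and odd: "\<And>t. t \<in> octahedral_sphere n \<Longrightarrow> \<Phi> (\<lambda>i. - t i) = - \<Phi> t"
  shows "genus (\<Phi> ` octahedral_sphere n) \<ge> enat (Suc n)"
  unfolding genus_def
proof (rule Inf_greatest, clarify)
  let ?S = "octahedral_sphere n"
  fix m g
  assume g: "continuous_map (top_of_set (\<Phi> ` ?S)) (Euclidean_space m) g"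
    and g_odd: "\<forall>x\<in>\<Phi> ` ?S. g (- x) = (\<lambda>i. - g x i)" and g_nz: "\<forall>x\<in>\<Phi> ` ?S. g x \<noteq> (\<lambda>i. 0)"
  show "enat (Suc n) \<le> enat m"
  proof (rule ccontr)
    assume "\<not> ?thesis"
    then have m: "m \<le> n" by simp
    have "continuous_on (\<Phi> ` ?S) (\<lambda>x. g x i)" for i
      using g unfolding Euclidean_space_def
      by (simp add: continuous_map_in_subtopology continuous_map_componentwise_UNIV)
    then have "continuous_on ?S (\<lambda>t. g (\<Phi> t) i)" for i
      by (rule continuous_on_compose2[OF _ cont]) auto
    then obtain t where t: "t \<in> ?S" "\<forall>i<n. g (\<Phi> t) i = 0"
      using borsuk_ulam[of n "\<lambda>t. g (\<Phi> t)"] odd g_odd by auto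
    have "g (\<Phi> t) i = 0" if "m \<le> i" for i
      using g t(1) that unfolding Euclidean_space_def
      by (auto simp: continuous_map_in_subtopology Pi_iff image_subset_iff)
    with t m have "g (\<Phi> t) = (\<lambda>i. 0)"
      by (metis (no_types) less_le_trans not_le ext)
    then show False using g_nz t by blast
  qed
qed

section \<open>Signed indicators and the functional \<open>I_plus\<close>\<close>

definition signed_indicator :: "'v::finite set \<Rightarrow> 'v set \<Rightarrow> real^'v" where
  "signed_indicator A B = (\<chi> i. if i \<in> A then 1 else if i \<in> B then - 1 else 0)"

lemma sum_vertex_degree:
  fixes E :: "'v::finite set set"
  shows "(\<Sum>i\<in>S. real (vertex_degree E i)) = (\<Sum>e\<in>E. real (card (e \<inter> S)))"
proof -
  have "(\<Sum>i\<in>S. real (vertex_degree E i)) = (\<Sum>i\<in>S. \<Sum>e\<in>E. of_bool (i \<in> e))"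
    by (intro sum.cong refl) (simp add: vertex_degree_def Collect_conj_eq)
  also have "\<dots> = (\<Sum>e\<in>E. \<Sum>i\<in>S. of_bool (i \<in> e))" by (rule sum.swap)
  also have "\<dots> = (\<Sum>e\<in>E. real (card (e \<inter> S)))"
    by (intro sum.cong refl) (simp add: Int_commute)
  finally show ?thesis .
qed

text \<open>An edge contributes the number of its ends in \<open>A \<union> B\<close>, except that
  the ends cancel when one lies in \<open>A\<close> and the other in \<open>B\<close>. The numbers
  of ends add up to the volume.\<close>

lemma I_plus_signed_indicator:
  fixes E :: "'v::finite set set"
  assumes "simple_graph E" "A \<inter> B = {}"
  shows "I_plus E (signed_indicator A B) = real (vol E (A \<union> B)) - 2 * real (card (edges_between E A B))"
proof -
  have edge: "\<bar>\<Sum>i\<in>e. signed_indicator A B $ i\<bar> = real (card (e \<inter> (A \<union> B))) - 2 * of_bool (e \<in> edges_between E A B)"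
    if "e \<in> E" for e
  proof -
    have "card e = 2" using assms(1) that by (simp add: simple_graph_def)
    then obtain a b where e: "e = {a, b}" "a \<noteq> b" by (auto simp: card_2_iff)
    have "e \<in> edges_between E A B \<longleftrightarrow> a \<in> A \<and> b \<in> B \<or> b \<in> A \<and> a \<in> B"
      using that e by (auto simp: edges_between_def doubleton_eq_iff)
    then show ?thesis
      using e assms(2) by (auto simp: signed_indicator_def Int_insert_left)
  qed
  have "I_plus E (signed_indicator A B) =
    (\<Sum>e\<in>E. real (card (e \<inter> (A \<union> B))) - 2 * of_bool (e \<in> edges_between E A B))"
    unfolding I_plus_def by (intro sum.cong refl edge)
  also have "\<dots> = (\<Sum>e\<in>E. real (card (e \<inter> (A \<union> B)))) - 2 * (\<Sum>e\<in>E. of_bool (e \<in> edges_between E A B))"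
    by (simp only: sum_subtractf sum_distrib_left)
  also have "(\<Sum>e\<in>E. of_bool (e \<in> edges_between E A B)) = real (card (edges_between E A B))"
  proof -
    have "E \<inter> {e. e \<in> edges_between E A B} = edges_between E A B" by (auto simp: edges_between_def)
    then show ?thesis by simp
  qed
  finally show ?thesis by (simp add: vol_def sum_vertex_degree)
qed

lemma vol_pos:
  assumes "no_isolated_vertices E" "S \<noteq> {}"
  shows "vol E S > 0"
proof -
  obtain i where "i \<in> S" using assms(2) by blast
  then show ?thesis
    using assms(1) unfolding vol_def no_isolated_vertices_def by (intro sum_pos2[of _ i]) auto
qed

lemma I_plus_nonneg: "I_plus E x \<ge> 0"
  unfolding I_plus_def by (intro sum_nonneg) auto

lemma continuous_on_I_plus: "continuous_on A (I_plus E)"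
  unfolding I_plus_def by (intro continuous_intros)

lemma I_plus_scaleR: "I_plus E (c *\<^sub>R x) = \<bar>c\<bar> * I_plus E x"
  by (simp add: I_plus_def abs_mult flip: sum_distrib_left)

lemma I_plus_sum_le: "I_plus E (\<Sum>i\<in>I. f i) \<le> (\<Sum>i\<in>I. I_plus E (f i))"
proof -
  have "I_plus E (\<Sum>i\<in>I. f i) = (\<Sum>e\<in>E. \<bar>\<Sum>i\<in>I. \<Sum>j\<in>e. f i $ j\<bar>)"
    unfolding I_plus_def sum_component by (subst sum.swap) simp
  also have "\<dots> \<le> (\<Sum>e\<in>E. \<Sum>i\<in>I. \<bar>\<Sum>j\<in>e. f i $ j\<bar>)"
    by (intro sum_mono sum_abs)
  also have "\<dots> = (\<Sum>i\<in>I. I_plus E (f i))"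
    unfolding I_plus_def by (rule sum.swap)
  finally show ?thesis .
qed

text \<open>A member bounds a real infimum only if the family is bounded below. Compactness makes
  the suprema genuine, and \<open>k > 0\<close> excludes the empty set, whose supremum is
  unspecified.\<close>

lemma minimax_c_le:
  fixes E :: "'v::finite set set"
  assumes "A \<subseteq> X_sphere E" "compact A" "A = uminus ` A" "genus A \<ge> enat k" "k > 0"
    and "\<And>x. x \<in> A \<Longrightarrow> I_plus E x \<le> c"
  shows "minimax_c E k \<le> c"
proof -
  have nonempty: "A' \<noteq> {}" if "genus A' \<ge> enat k" for A' :: "(real^'v) set"
    using that assms(5) by (auto simp: genus_empty) (simp add: zero_enat_def)
  let ?T = "{(SUP x\<in>A. I_plus E x) | A. A \<subseteq> X_sphere E \<and> compact A \<and> A = uminus ` A \<and> genus A \<ge> enat k}"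
  have "bdd_below ?T"
  proof (rule bdd_belowI[of _ 0], clarify)
    fix A' :: "(real^'v) set" assume A': "compact A'" "genus A' \<ge> enat k"
    then obtain x where "x \<in> A'" using nonempty by blast
    moreover have "bdd_above (I_plus E ` A')"
      by (intro bounded_imp_bdd_above compact_imp_bounded compact_continuous_image continuous_on_I_plus A')
    ultimately show "0 \<le> (SUP x\<in>A'. I_plus E x)"
      using cSUP_upper[of x A' "I_plus E"] I_plus_nonneg[of E x] by linarith
  qed
  then have "minimax_c E k \<le> (SUP x\<in>A. I_plus E x)"
    unfolding minimax_c_def using assms by (intro cInf_lower) auto
  also have "\<dots> \<le> c"
    using nonempty assms by (intro cSUP_least) auto
  finally show ?thesis .
qed

lemma minimax_c_le_disjoint_pairs:
  fixes E :: "'v::finite set set" and A B :: "nat \<Rightarrow> 'v set"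
  assumes E: "simple_graph E" "no_isolated_vertices E"
    and AB: "\<And>i. i \<le> n \<Longrightarrow> A i \<inter> B i = {}" "\<And>i. i \<le> n \<Longrightarrow> A i \<union> B i \<noteq> {}"
    and disj: "disjoint_family_on (\<lambda>i. A i \<union> B i) {..n}"
    and h: "\<And>i. i \<le> n \<Longrightarrow> h \<le> 2 * real (card (edges_between E (A i) (B i))) / real (vol E (A i \<union> B i))"
  shows "minimax_c E (Suc n) \<le> 1 - h"
proof -
  define S where "S = (\<lambda>i. A i \<union> B i)"
  define w where "w = (\<lambda>i. (1 / real (vol E (S i))) *\<^sub>R signed_indicator (A i) (B i))"
  define \<Phi> where "\<Phi> = (\<lambda>t. \<Sum>i\<le>n. t i *\<^sub>R w i)"
  have vol: "real (vol E (S i)) > 0" if "i \<le> n" for i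
    using vol_pos[OF E(2) AB(2)[OF that]] by (simp add: S_def)
  have supp: "w i $ j = 0" if "j \<notin> S i" for i j
    using that by (simp add: w_def S_def signed_indicator_def)
  have abs_w: "\<bar>w i $ j\<bar> = (if j \<in> S i then 1 / real (vol E (S i)) else 0)" for i j
    by (simp add: w_def S_def signed_indicator_def abs_divide)
  have I_w: "I_plus E (w i) \<le> 1 - h" if "i \<le> n" for i
    using h[OF that] vol[OF that] I_plus_signed_indicator[OF E(1) AB(1)[OF that]]
    by (simp add: w_def S_def I_plus_scaleR field_simps)
  \<comment> \<open>At each vertex at most one of the disjointly supported \<open>w i\<close> is
    nonzero, so absolute values add up. The weighted norm of \<open>\<Phi> t\<close> thereby becomes
    the l1 norm of \<open>t\<close>.\<close>
  have abs_\<Phi>: "\<bar>\<Phi> t $ j\<bar> = (\<Sum>i\<le>n. \<bar>t i\<bar> * \<bar>w i $ j\<bar>)" for t j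
  proof (cases "\<exists>i\<le>n. j \<in> S i")
    case True
    then obtain i where i: "i \<le> n" "j \<in> S i" by blast
    then have other: "w i' $ j = 0" if "i' \<in> {..n} - {i}" for i'
      using that disj by (intro supp) (auto simp: disjoint_family_on_def S_def)
    have "\<Phi> t $ j = t i * w i $ j"
      using i other by (simp add: \<Phi>_def sum.remove[of "{..n}" i])
    moreover have "(\<Sum>i\<le>n. \<bar>t i\<bar> * \<bar>w i $ j\<bar>) = \<bar>t i\<bar> * \<bar>w i $ j\<bar>"
      using i other by (simp add: sum.remove[of "{..n}" i])
    ultimately show ?thesis by (simp add: abs_mult)
  next
    case False
    then show ?thesis by (simp add: \<Phi>_def supp)
  qed
  have norm_w: "(\<Sum>j\<in>UNIV. real (vertex_degree E j) * \<bar>w i $ j\<bar>) = 1" if "i \<le> n" for i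
  proof -
    have "(\<Sum>j\<in>UNIV. real (vertex_degree E j) * \<bar>w i $ j\<bar>) = (\<Sum>j\<in>S i. real (vertex_degree E j) / real (vol E (S i)))"
      by (intro sum.mono_neutral_cong_right) (auto simp: abs_w)
    also have "\<dots> = 1"
      using vol[OF that] by (simp add: vol_def flip: sum_divide_distrib)
    finally show ?thesis .
  qed
  have \<Phi>_neg: "\<Phi> (\<lambda>i. - t i) = - \<Phi> t" for t
    by (simp add: \<Phi>_def sum_negf)
  have \<Phi>_cont: "continuous_on T \<Phi>" for T
    unfolding \<Phi>_def
    by (intro continuous_on_sum continuous_on_scaleR continuous_on_const
          continuous_on_subset[OF continuous_on_product_coordinates]) simp
  let ?K = "\<Phi> ` octahedral_sphere n"
  show ?thesis
  proof (rule minimax_c_le[of ?K])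
    show "?K \<subseteq> X_sphere E"
    proof clarify
      fix t :: "nat \<Rightarrow> real" assume t: "t \<in> octahedral_sphere n"
      have "(\<Sum>j\<in>UNIV. real (vertex_degree E j) * \<bar>\<Phi> t $ j\<bar>) =
        (\<Sum>j\<in>UNIV. \<Sum>i\<le>n. \<bar>t i\<bar> * (real (vertex_degree E j) * \<bar>w i $ j\<bar>))"
        by (simp add: abs_\<Phi> sum_distrib_left mult_ac)
      also have "\<dots> = (\<Sum>i\<le>n. \<bar>t i\<bar> * (\<Sum>j\<in>UNIV. real (vertex_degree E j) * \<bar>w i $ j\<bar>))"
        by (subst sum.swap) (simp add: sum_distrib_left)
      also have "\<dots> = 1" using t by (simp add: norm_w octahedral_sphere_def)
      finally show "\<Phi> t \<in> X_sphere E" by (simp add: X_sphere_def)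
    qed
    show "compact ?K" by (intro compact_continuous_image \<Phi>_cont compact_octahedral_sphere)
    have sub: "uminus ` ?K \<subseteq> ?K"
      using uminus_mem_octahedral_sphere by (auto simp flip: \<Phi>_neg)
    then have "uminus ` uminus ` ?K \<subseteq> uminus ` ?K" by (rule image_mono)
    with sub show "?K = uminus ` ?K" by (auto simp: image_image)
    show "genus ?K \<ge> enat (Suc n)"
      by (intro genus_odd_image_octahedral_sphere \<Phi>_cont \<Phi>_neg)
    show "I_plus E x \<le> 1 - h" if "x \<in> ?K" for x
    proof -
      obtain t where t: "x = \<Phi> t" "t \<in> octahedral_sphere n" using \<open>x \<in> ?K\<close> by blast
      have "I_plus E x \<le> (\<Sum>i\<le>n. \<bar>t i\<bar> * I_plus E (w i))"
        using I_plus_sum_le[of E "\<lambda>i. t i *\<^sub>R w i" "{..n}"] by (simp add: t \<Phi>_def I_plus_scaleR)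
      also have "\<dots> \<le> (\<Sum>i\<le>n. \<bar>t i\<bar> * (1 - h))"
        by (intro sum_mono mult_left_mono I_w) auto
      also have "\<dots> = 1 - h"
        using t by (simp add: octahedral_sphere_def flip: sum_distrib_right)
      finally show ?thesis .
    qed
  qed simp
qed

section \<open>The dual Cheeger constant as an attained maximum\<close>

definition dual_cheeger_value :: "'v::finite set set \<Rightarrow> nat \<Rightarrow> (nat \<Rightarrow> 'v set) \<Rightarrow> real" where
  "dual_cheeger_value E k V =
     (MIN i\<in>{1..k}. 2 * real (card (edges_between E (V (2 * i - 1)) (V (2 * i))))
                    / real (vol E (V (2 * i - 1) \<union> V (2 * i))))"

definition admissible_family :: "nat \<Rightarrow> (nat \<Rightarrow> 'v set) \<Rightarrow> bool" where
  "admissible_family k V \<longleftrightarrow>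
     disjoint_family_on V {1..2 * k} \<and> (\<forall>i\<in>{1..k}. V (2 * i - 1) \<union> V (2 * i) \<noteq> {})"

lemma dual_cheeger_eq:
  "dual_cheeger E k = Max {dual_cheeger_value E k V | V. admissible_family k V}"
  by (simp add: dual_cheeger_def dual_cheeger_value_def admissible_family_def)

text \<open>There are infinitely many families, being functions on all of \<open>nat\<close>, but
  each value is twice a quotient of two bounded natural numbers.\<close>

lemma finite_dual_cheeger_values:
  fixes E :: "'v::finite set set"
  assumes "k > 0"
  shows "finite {dual_cheeger_value E k V | V. admissible_family k V}"
proof (rule finite_subset)
  show "{dual_cheeger_value E k V | V. admissible_family k V} \<subseteq>
    (\<lambda>(a, b). 2 * real a / real b) ` ({..card E} \<times> {..vol E UNIV})"
  proof clarify
    fix V :: "nat \<Rightarrow> 'v set"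
    have "dual_cheeger_value E k V \<in>
      (\<lambda>i. 2 * real (card (edges_between E (V (2 * i - 1)) (V (2 * i)))) / real (vol E (V (2 * i - 1) \<union> V (2 * i)))) ` {1..k}"
      unfolding dual_cheeger_value_def using assms by (intro Min_in) auto
    then obtain i where i: "dual_cheeger_value E k V =
      2 * real (card (edges_between E (V (2 * i - 1)) (V (2 * i)))) / real (vol E (V (2 * i - 1) \<union> V (2 * i)))"
      by blast
    have "card (edges_between E (V (2 * i - 1)) (V (2 * i))) \<le> card E"
      by (intro card_mono) (auto simp: edges_between_def)
    moreover have "vol E (V (2 * i - 1) \<union> V (2 * i)) \<le> vol E UNIV"
      unfolding vol_def by (intro sum_mono2) auto
    ultimately show "dual_cheeger_value E k V \<in> (\<lambda>(a, b). 2 * real a / real b) ` ({..card E} \<times> {..vol E UNIV})"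
      unfolding i by (intro image_eqI[of _ _ "(_, _)"]) auto
  qed
qed auto

text \<open>Pairs made of a singleton and the empty set suffice: slot 2 i - 1 receives vertex number
  i - 1. With finiteness this ensures that the maximum is attained.\<close>

lemma admissible_family_exists:
  assumes "k \<le> CARD('v)"
  shows "\<exists>V :: nat \<Rightarrow> 'v::finite set. admissible_family k V"
proof -
  obtain f :: "nat \<Rightarrow> 'v" where f: "inj_on f {0..<CARD('v)}"
    using ex_bij_betw_nat_finite[of "UNIV :: 'v set"] by (auto simp: bij_betw_def)
  define V where "V = (\<lambda>m. if odd m then {f (m div 2)} else {})"
  have "V m \<inter> V m' = {}" if "m \<in> {1..2 * k}" "m' \<in> {1..2 * k}" "m \<noteq> m'" for m m'
  proof (cases "odd m \<and> odd m'")
    case True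
    then have "m div 2 \<noteq> m' div 2" using that(3) by (metis odd_two_times_div_two_succ)
    moreover have "m div 2 < CARD('v)" "m' div 2 < CARD('v)"
      using True that assms by (auto elim!: oddE)
    ultimately show ?thesis using f by (auto simp: V_def inj_on_def)
  qed (auto simp: V_def)
  moreover have "V (2 * i - 1) \<noteq> {}" if "i \<in> {1..k}" for i
    using that by (simp add: V_def)
  ultimately show ?thesis
    unfolding admissible_family_def disjoint_family_on_def by (intro exI[of _ V]) auto
qed

lemma minimax_c_le_one_minus_dual_cheeger:
  fixes E :: "'v::finite set set"
  assumes E: "simple_graph E" "no_isolated_vertices E" and k: "k \<in> {1..CARD('v)}"
  shows "minimax_c E k \<le> 1 - dual_cheeger E k"
proof -
  have "dual_cheeger E k \<in> {dual_cheeger_value E k V | V. admissible_family k V}"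
    unfolding dual_cheeger_eq
    using k admissible_family_exists[of k] finite_dual_cheeger_values[of k E] by (intro Max_in) auto
  then obtain V where V: "dual_cheeger E k = dual_cheeger_value E k V" "admissible_family k V"
    by blast
  obtain n where n: "k = Suc n" using k by (cases k) auto
  have dis: "V m \<inter> V m' = {}" if "m \<in> {1..2 * k}" "m' \<in> {1..2 * k}" "m \<noteq> m'" for m m'
    using V(2) that by (auto simp: admissible_family_def disjoint_family_on_def)
  show ?thesis
    unfolding n
  \<comment> \<open>The pairs are numbered from 0 in the test set and from 1 in
    \<open>dual_cheeger\<close>.\<close>
  proof (rule minimax_c_le_disjoint_pairs[OF E, where A = "\<lambda>i. V (2 * Suc i - 1)" and B = "\<lambda>i. V (2 * Suc i)"])
    fix i assume i: "i \<le> n"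
    then show "V (2 * Suc i - 1) \<inter> V (2 * Suc i) = {}"
      using n by (intro dis) auto
    have "Suc i \<in> {1..k}" using i n by auto
    then show "V (2 * Suc i - 1) \<union> V (2 * Suc i) \<noteq> {}"
      using V(2) unfolding admissible_family_def by blast
    show "dual_cheeger E (Suc n) \<le> 2 * real (card (edges_between E (V (2 * Suc i - 1)) (V (2 * Suc i))))
        / real (vol E (V (2 * Suc i - 1) \<union> V (2 * Suc i)))"
      unfolding n[symmetric] V(1) dual_cheeger_value_def
      by (intro Min_le finite_imageI finite_atLeastAtMost image_eqI[where x = "Suc i"] refl \<open>Suc i \<in> {1..k}\<close>)
  next
    show "disjoint_family_on (\<lambda>i. V (2 * Suc i - 1) \<union> V (2 * Suc i)) {..n}"
      unfolding disjoint_family_on_def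
    proof (intro ballI impI)
      fix i j assume ij: "i \<in> {..n}" "j \<in> {..n}" "i \<noteq> j"
      have "V a \<inter> V b = {}" if "a \<in> {2 * Suc i - 1, 2 * Suc i}" "b \<in> {2 * Suc j - 1, 2 * Suc j}" for a b
        using that ij n by (intro dis) auto
      then show "(V (2 * Suc i - 1) \<union> V (2 * Suc i)) \<inter> (V (2 * Suc j - 1) \<union> V (2 * Suc j)) = {}"
        by blast
    qed
  qed
qed

section \<open>Nodal domains\<close>

lemma bij_betw_neighbours:
  assumes "simple_graph E"
  shows "bij_betw (\<lambda>j. {i, j}) {j. {i, j} \<in> E} {e \<in> E. i \<in> e}"
proof -
  have "\<exists>j. e = {i, j}" if "e \<in> E" "i \<in> e" for e
    using assms that by (auto simp: simple_graph_def card_2_iff)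
  then show ?thesis
    by (auto simp: bij_betw_def inj_on_def doubleton_eq_iff)
qed

lemma vertex_degree_eq_card_neighbours:
  "simple_graph E \<Longrightarrow> vertex_degree E i = card {j. {i, j} \<in> E}"
  unfolding vertex_degree_def using bij_betw_same_card[OF bij_betw_neighbours] by metis

lemma card_edges_between:
  assumes "A \<inter> B = {}"
  shows "card (edges_between E A B) = card {(i, j). i \<in> A \<and> j \<in> B \<and> {i, j} \<in> E}"
proof -
  have "bij_betw (\<lambda>(i, j). {i, j}) {(i, j). i \<in> A \<and> j \<in> B \<and> {i, j} \<in> E} (edges_between E A B)"
    using assms by (auto simp: bij_betw_def inj_on_def edges_between_def doubleton_eq_iff)
  then show ?thesis by (simp add: bij_betw_same_card)
qed

text \<open>
  Testing the eigenvalue equation against \<open>sgn x\<close> on \<open>D\<close>: an edge joining opposite signs inside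
  \<open>D\<close> is counted from both ends with opposite contributions, every other edge end contributes 1.
\<close>

lemma eigenpair_sign_closed_set:
  fixes E :: "'v::finite set set" and x :: "real^'v"
  assumes E: "simple_graph E" and eig: "eigenpair E lam x"
    and D: "\<And>i. i \<in> D \<Longrightarrow> x $ i \<noteq> 0"
    and closed: "\<And>i j. i \<in> D \<Longrightarrow> {i, j} \<in> E \<Longrightarrow> x $ j \<noteq> 0 \<Longrightarrow> j \<in> D"
  shows "2 * real (card (edges_between E {i \<in> D. x $ i > 0} {i \<in> D. x $ i < 0})) = (1 - lam) * real (vol E D)"
proof -
  let ?A = "{i \<in> D. x $ i > 0}" and ?B = "{i \<in> D. x $ i < 0}"
  obtain y w where y: "y \<in> signless_one_laplacian E x" and w: "w \<in> weighted_Sgn E x" "y = lam *\<^sub>R w"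
    using eig unfolding eigenpair_def by blast
  obtain z where z: "\<And>i j. {i, j} \<in> E \<Longrightarrow> z i j \<in> Sgn (x $ i + x $ j) \<and> z i j = z j i"
    and yz: "\<And>i. y $ i = (\<Sum>j | {i, j} \<in> E. z i j)"
    using y unfolding signless_one_laplacian_def by blast
  obtain s where s: "\<And>i. s i \<in> Sgn (x $ i)" "\<And>i. w $ i = real (vertex_degree E i) * s i"
    using w(1) unfolding weighted_Sgn_def by blast
  have s_sgn: "sgn (x $ i) * s i = 1" if "i \<in> D" for i
    using s(1)[of i] D[OF that] by (auto simp: Sgn_def sgn_if split: if_splits)
  \<comment> \<open>All edge ends in \<open>D\<close>. The other end \<open>j\<close> may lie
    outside \<open>D\<close>, but then \<open>x\<close> vanishes there by
    \<open>closed\<close>.\<close>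
  define P where "P = Sigma D (\<lambda>i. {j. {i, j} \<in> E})"
  define Opp where "Opp = {(i, j) \<in> P. x $ i * x $ j < 0}"
  have Opp_swap: "(j, i) \<in> Opp" if "(i, j) \<in> Opp" for i j
  proof -
    have ij: "i \<in> D" "{i, j} \<in> E" "x $ i * x $ j < 0" using that by (auto simp: Opp_def P_def)
    then have "x $ j \<noteq> 0" by auto
    then have "j \<in> D" using ij closed by blast
    then show ?thesis using ij by (simp add: Opp_def P_def insert_commute mult.commute)
  qed
  have card_P: "real (card P) = real (vol E D)"
    by (simp add: P_def vol_def vertex_degree_eq_card_neighbours[OF E])
  have "lam * real (vol E D) = (\<Sum>i\<in>D. lam * real (vertex_degree E i) * (sgn (x $ i) * s i))"
    by (simp add: vol_def s_sgn sum_distrib_left)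
  also have "\<dots> = (\<Sum>i\<in>D. sgn (x $ i) * y $ i)"
    by (simp add: w(2) s(2) mult_ac)
  also have "\<dots> = (\<Sum>(i, j)\<in>P. sgn (x $ i) * z i j)"
    unfolding P_def by (subst sum.Sigma[symmetric]) (auto simp: yz sum_distrib_left)
  also have "\<dots> = (\<Sum>(i, j)\<in>P - Opp. sgn (x $ i) * z i j) + (\<Sum>(i, j)\<in>Opp. sgn (x $ i) * z i j)"
    by (rule sum.subset_diff) (auto simp: Opp_def)
  also have "(\<Sum>(i, j)\<in>P - Opp. sgn (x $ i) * z i j) = (\<Sum>p\<in>P - Opp. 1)"
  proof (intro sum.cong refl, clarify)
    \<comment> \<open>Here \<open>x $ j\<close> is zero or has the sign of the nonzero
      \<open>x $ i\<close>, so \<open>Sgn (x $ i + x $ j)\<close> is a singleton consisting of that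
      sign.\<close>
    fix i j assume ij: "(i, j) \<in> P" "(i, j) \<notin> Opp"
    then have "x $ i \<noteq> 0" "\<not> x $ i * x $ j < 0" "z i j \<in> Sgn (x $ i + x $ j)"
      using D z by (auto simp: P_def Opp_def)
    then show "sgn (x $ i) * z i j = 1"
      by (cases "x $ i > 0") (auto simp: Sgn_def mult_less_0_iff not_less)
  qed
  also have "(\<Sum>(i, j)\<in>Opp. sgn (x $ i) * z i j) = 0"
  proof -
    \<comment> \<open>Exchanging the ends preserves the symmetric \<open>z\<close> and reverses the
      sign of \<open>sgn (x $ i)\<close>, so the sum equals its own negative.\<close>
    have "(\<Sum>(i, j)\<in>Opp. sgn (x $ i) * z i j) = (\<Sum>(i, j)\<in>Opp. - (sgn (x $ i) * z i j))"
    proof (rule sum.reindex_bij_witness[of _ prod.swap prod.swap])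
      show "prod.swap p \<in> Opp" if "p \<in> Opp" for p
        using that by (cases p) (simp add: Opp_swap)
      then show "prod.swap p \<in> Opp" if "p \<in> Opp" for p
        using that .
      show "(case prod.swap p of (i, j) \<Rightarrow> - (sgn (x $ i) * z i j)) = (case p of (i, j) \<Rightarrow> sgn (x $ i) * z i j)"
        if "p \<in> Opp" for p
      proof -
        obtain i j where p: "p = (i, j)" by (cases p)
        have "z i j = z j i" using z that p by (auto simp: Opp_def P_def)
        moreover have "sgn (x $ i) = - sgn (x $ j)"
          using that p by (auto simp: Opp_def mult_less_0_iff)
        ultimately show ?thesis by (simp add: p)
      qed
    qed auto
    then show ?thesis by (simp add: case_prod_unfold sum_negf)
  qed
  finally have main: "lam * real (vol E D) = real (card (P - Opp))" by simp
  have "card Opp = 2 * card (edges_between E ?A ?B)"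
  proof -
    let ?O = "{(i, j). i \<in> ?A \<and> j \<in> ?B \<and> {i, j} \<in> E}"
    have "Opp = ?O \<union> prod.swap ` ?O"
      using closed by (force simp: Opp_def P_def mult_less_0_iff insert_commute image_iff)
    moreover have "?O \<inter> prod.swap ` ?O = {}" by auto
    ultimately have "card Opp = card ?O + card (prod.swap ` ?O)"
      by (simp add: card_Un_disjoint)
    also have "card (prod.swap ` ?O) = card ?O"
      by (intro card_image) auto
    also have "card ?O = card (edges_between E ?A ?B)"
      by (rule card_edges_between[symmetric]) auto
    finally show ?thesis by simp
  qed
  moreover have "real (card (P - Opp)) = real (card P) - real (card Opp)"
  proof -
    have "Opp \<subseteq> P" by (auto simp: Opp_def)
    then show ?thesis by (simp add: card_Diff_subset of_nat_diff card_mono)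
  qed
  ultimately show ?thesis using main card_P by (simp add: algebra_simps)
qed

text \<open>Adjacency within the support is symmetric and never leaves the support, so the classes
  of its reflexive transitive closure that start in the support partition it.\<close>

lemma nodal_domain_properties:
  fixes E :: "'v::finite set set" and x :: "real^'v"
  assumes "Q \<in> nodal_domains E x"
  shows "Q \<noteq> {}"
    and "i \<in> Q \<Longrightarrow> x $ i \<noteq> 0"
    and "i \<in> Q \<Longrightarrow> {i, j} \<in> E \<Longrightarrow> x $ j \<noteq> 0 \<Longrightarrow> j \<in> Q"
    and "Q' \<in> nodal_domains E x \<Longrightarrow> Q \<noteq> Q' \<Longrightarrow> Q \<inter> Q' = {}"
proof -
  define R where "R = {(i, j). x $ i \<noteq> 0 \<and> x $ j \<noteq> 0 \<and> {i, j} \<in> E}"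
  have classes: "\<exists>a. x $ a \<noteq> 0 \<and> T = R\<^sup>* `` {a}" if "T \<in> nodal_domains E x" for T
    using that unfolding nodal_domains_def R_def[symmetric] quotient_def by simp
  obtain a where a: "x $ a \<noteq> 0" "Q = R\<^sup>* `` {a}" using classes[OF assms] by blast
  show "Q \<noteq> {}" using a(2) by blast
  have nz: "x $ i \<noteq> 0" if "(a, i) \<in> R\<^sup>*" for i
    using that a(1) by (induction rule: rtrancl_induct) (auto simp: R_def)
  then show "x $ i \<noteq> 0" if "i \<in> Q" using that a(2) by simp
  show "j \<in> Q" if "i \<in> Q" "{i, j} \<in> E" "x $ j \<noteq> 0"
  proof -
    have i: "(a, i) \<in> R\<^sup>*" using that a(2) by simp
    then have "(i, j) \<in> R" using that nz[OF i] by (simp add: R_def)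
    with i have "(a, j) \<in> R\<^sup>*" by (rule rtrancl_into_rtrancl)
    then show ?thesis using a(2) by simp
  qed
  show "Q \<inter> Q' = {}" if Q': "Q' \<in> nodal_domains E x" and "Q \<noteq> Q'"
  proof (rule ccontr)
    assume "Q \<inter> Q' \<noteq> {}"
    obtain b where b: "Q' = R\<^sup>* `` {b}" using classes[OF Q'] by blast
    have R_sym: "sym (R\<^sup>*)" by (intro sym_rtrancl symI) (auto simp: R_def insert_commute)
    obtain c where c: "(a, c) \<in> R\<^sup>*" "(b, c) \<in> R\<^sup>*" using \<open>Q \<inter> Q' \<noteq> {}\<close> a(2) b by blast
    have ab: "(a, b) \<in> R\<^sup>*" "(b, a) \<in> R\<^sup>*"
      using rtrancl_trans[OF c(1) symD[OF R_sym c(2)]] rtrancl_trans[OF c(2) symD[OF R_sym c(1)]] .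
    have "(a, d) \<in> R\<^sup>* \<longleftrightarrow> (b, d) \<in> R\<^sup>*" for d
      using rtrancl_trans[OF ab(1)] rtrancl_trans[OF ab(2)] by blast
    then have "Q = Q'" unfolding a(2) b by blast
    then show False using \<open>Q \<noteq> Q'\<close> by simp
  qed
qed

text \<open>As nodal domains are disjoint, their sign splits form one admissible family, all of
  whose ratios equal \<open>1 - lam\<close>; the maximum over families is at least that. This works
  for every eigenvalue \<open>lam\<close>.\<close>

lemma one_minus_dual_cheeger_nodal_domains_le:
  fixes E :: "'v::finite set set" and x :: "real^'v"
  assumes E: "simple_graph E" "no_isolated_vertices E" and eig: "eigenpair E lam x"
  shows "1 - dual_cheeger E (card (nodal_domains E x)) \<le> lam"
proof -
  let ?C = "nodal_domains E x"
  define k where "k = card ?C"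
  obtain f where f: "bij_betw f {0..<k} ?C"
    using ex_bij_betw_nat_finite[of ?C] unfolding k_def by auto
  have fC: "f m \<in> ?C" if "m < k" for m using f that by (auto simp: bij_betw_def)
  have "x \<noteq> 0" using eig by (simp add: eigenpair_def)
  then obtain a where "x $ a \<noteq> 0" by (auto simp: vec_eq_iff)
  \<comment> \<open>A nonzero vector has a nodal domain, so the minimum below is taken over a
    nonempty index set.\<close>
  then have "?C \<noteq> {}" by (auto simp: nodal_domains_def quotient_def)
  then have k: "k > 0" by (simp add: k_def card_gt_0_iff)
  \<comment> \<open>Slots \<open>2 * i - 1\<close> and \<open>2 * i\<close> hold the positive and
    the negative part of domain number \<open>i - 1\<close>, as domains are numbered from 0.\<close>
  define V where "V = (\<lambda>m. {i \<in> f ((m - 1) div 2). if odd m then x $ i > 0 else x $ i < 0})"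
  have V_odd: "V (2 * i - 1) = {j \<in> f (i - 1). x $ j > 0}" if "i \<in> {1..k}" for i
  proof -
    have "(2 * i - 1 - 1) div 2 = i - 1" "odd (2 * i - 1)" using that by auto
    then show ?thesis by (simp add: V_def)
  qed
  have V_even: "V (2 * i) = {j \<in> f (i - 1). x $ j < 0}" if "i \<in> {1..k}" for i
  proof -
    have "(2 * i - 1) div 2 = i - 1" using that by auto
    then show ?thesis by (simp add: V_def)
  qed
  have V_un: "V (2 * i - 1) \<union> V (2 * i) = f (i - 1)" if "i \<in> {1..k}" for i
    using nodal_domain_properties(2)[OF fC, of "i - 1"] that
    unfolding V_odd[OF that] V_even[OF that] by fastforce
  have disj: "V m \<inter> V m' = {}" if "m \<in> {1..2 * k}" "m' \<in> {1..2 * k}" "m \<noteq> m'" for m m'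
  proof (cases "(m - 1) div 2 = (m' - 1) div 2")
    case True
    then have "odd m \<noteq> odd m'" using that by presburger
    then show ?thesis using True by (auto simp: V_def)
  next
    case False
    have lt: "(m - 1) div 2 < k" "(m' - 1) div 2 < k" using that by auto
    then have "f ((m - 1) div 2) \<noteq> f ((m' - 1) div 2)"
      using f False by (auto simp: bij_betw_def inj_on_def)
    then show ?thesis
      using nodal_domain_properties(4)[OF fC[OF lt(1)] fC[OF lt(2)]] by (auto simp: V_def)
  qed
  have "admissible_family k V"
    unfolding admissible_family_def disjoint_family_on_def
    using disj V_un nodal_domain_properties(1)[OF fC] by auto
  then have "dual_cheeger_value E k V \<le> dual_cheeger E k"
    unfolding dual_cheeger_eq using finite_dual_cheeger_values[OF k] by (intro Max_ge) auto
  moreover have "1 - lam \<le> dual_cheeger_value E k V"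
    unfolding dual_cheeger_value_def
  proof (rule Min.boundedI)
    fix r assume "r \<in> (\<lambda>i. 2 * real (card (edges_between E (V (2 * i - 1)) (V (2 * i))))
      / real (vol E (V (2 * i - 1) \<union> V (2 * i)))) ` {1..k}"
    then obtain i where i: "i \<in> {1..k}" and r: "r = 2 * real (card (edges_between E (V (2 * i - 1)) (V (2 * i))))
      / real (vol E (V (2 * i - 1) \<union> V (2 * i)))" by blast
    have Q: "f (i - 1) \<in> ?C" using i by (intro fC) auto
    have "2 * real (card (edges_between E {j \<in> f (i - 1). x $ j > 0} {j \<in> f (i - 1). x $ j < 0})) =
      (1 - lam) * real (vol E (f (i - 1)))"
      by (rule eigenpair_sign_closed_set[OF E(1) eig nodal_domain_properties(2,3)[OF Q]])
    moreover have "vol E (f (i - 1)) > 0"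
      using vol_pos[OF E(2) nodal_domain_properties(1)[OF Q]] .
    ultimately show "1 - lam \<le> r"
      unfolding r V_un[OF i] unfolding V_odd[OF i] V_even[OF i] by simp
  qed (use k in auto)
  ultimately show ?thesis by (simp add: k_def)
qed

theorem theorem3p6:
  fixes E :: "'v::finite set set" and k :: nat
  assumes "simple_graph E"
    and "no_isolated_vertices E"
    and "k \<in> {1..CARD('v)}"
  shows "minimax_c E k \<le> 1 - dual_cheeger E k \<and>
         (\<forall>x :: real^'v. eigenpair E (minimax_c E k) x \<longrightarrow>
            1 - dual_cheeger E (card (nodal_domains E x)) \<le> minimax_c E k)"
  using minimax_c_le_one_minus_dual_cheeger[OF assms]
    one_minus_dual_cheeger_nodal_domains_le[OF assms(1,2)] by blast

end
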